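(* Let $G$ be a finitely generated para-$\mathfrak{Nil}$-Hamiltonian group containing a nilpotent subgroup of finite index. Then $\gamma_n(G)$ is finite for some positive integer $n$. Moreover, if $G$ is insoluble, then $G$ is finite.
   Context: A group is minimal non-nilpotent if it is not nilpotent but all its proper subgroups are nilpotent. A group $G$ is para-$\mathfrak{Nil}$-Hamiltonian if $G$ is non-nilpotent and every non-normal subgroup of $G$ is either nilpotent or minimal non-nilpotent. $\gamma_n(G)$ is the $n$-th term of the lower central series ($\gamma_1(G)=G$, $\gamma_{n+1}(G)=[\gamma_n(G),G]$). *)

theory Defs
  imports "HOL-Algebra.Solvable_Groups" "HOL-Algebra.Coset"
begin

definition commutator :: "('a, 'b) monoid_scheme \<Rightarrow> 'a \<Rightarrow> 'a \<Rightarrow> 'a" where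
  "commutator G x y = inv\<^bsub>G\<^esub> x \<otimes>\<^bsub>G\<^esub> inv\<^bsub>G\<^esub> y \<otimes>\<^bsub>G\<^esub> x \<otimes>\<^bsub>G\<^esub> y"

primrec lcs :: "('a, 'b) monoid_scheme \<Rightarrow> nat \<Rightarrow> 'a set" where
  "lcs G 0 = carrier G"
| "lcs G (Suc k) = generate G {commutator G x y | x y. x \<in> lcs G k \<and> y \<in> carrier G}"

text \<open>The paper's gamma_n (1-indexed): gamma_1 = G, gamma_(n+1) = [gamma_n, G].\<close>
definition gamma :: "('a, 'b) monoid_scheme \<Rightarrow> nat \<Rightarrow> 'a set" where
  "gamma G n = lcs G (n - 1)"

definition nilpotent_group :: "('a, 'b) monoid_scheme \<Rightarrow> bool" where
  "nilpotent_group G \<longleftrightarrow> group G \<and> (\<exists>c. lcs G c = {\<one>\<^bsub>G\<^esub>})"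

definition minimal_non_nilpotent :: "('a, 'b) monoid_scheme \<Rightarrow> bool" where
  "minimal_non_nilpotent G \<longleftrightarrow> group G \<and> \<not> nilpotent_group G \<and>
     (\<forall>H. subgroup H G \<and> H \<noteq> carrier G \<longrightarrow> nilpotent_group (G\<lparr>carrier := H\<rparr>))"

definition para_Nil_Hamiltonian :: "('a, 'b) monoid_scheme \<Rightarrow> bool" where
  "para_Nil_Hamiltonian G \<longleftrightarrow> group G \<and> \<not> nilpotent_group G \<and>
     (\<forall>H. subgroup H G \<and> \<not> (H \<lhd> G) \<longrightarrow>
        nilpotent_group (G\<lparr>carrier := H\<rparr>) \<or> minimal_non_nilpotent (G\<lparr>carrier := H\<rparr>))"

definition finitely_generated_group :: "('a, 'b) monoid_scheme \<Rightarrow> bool" where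
  "finitely_generated_group G \<longleftrightarrow> (\<exists>S. finite S \<and> S \<subseteq> carrier G \<and> generate G S = carrier G)"

end

theory Submission
  imports Defs "HOL-Algebra.Group_Action" "HOL-Algebra.Multiplicative_Group"
    "HOL-Algebra.SimpleGroups"
begin

text \<open>
  In a para-Nil-Hamiltonian group every subgroup that properly contains a non-nilpotent subgroup
  is normal.

  Let \<open>N\<close> be a normal nilpotent subgroup of finite index with lower central series
  \<open>N = N\<^sub>0 \<ge> N\<^sub>1 \<ge> \<dots>\<close>. Going down this series, one shows that some \<open>\<gamma>\<^sub>n(G)\<close> is finite modulo \<open>N\<^sub>i\<close>.
  In \<open>G / N\<^sub>i\<^sub>+\<^sub>1\<close>, let \<open>A = (N\<^sub>i / N\<^sub>i\<^sub>+\<^sub>1)\<^sup>t\<close> be torsion-free. Each \<open>x\<close> acts on \<open>A\<close> with some finite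
  order \<open>k\<close>; put \<open>D = [A, x]\<close>. If \<open>d = [a, x]\<close> and \<open>[d, x] \<in> E\<close> for an \<open>x\<close>-invariant \<open>E \<le> A\<close>, then
  \<open>a = x\<^sup>-\<^sup>k a x\<^sup>k \<in> a d\<^sup>k E\<close> and so \<open>d\<^sup>k \<in> E\<close>. In particular \<open>x\<close> has no nontrivial fixed points in
  \<open>D\<close>, and \<open>D\<^sup>m\<langle>x\<rangle>\<close> is not nilpotent unless \<open>D\<close> is trivial. Were \<open>D\<^sup>m \<noteq> D\<close>, then \<open>D\<^sup>n\<langle>x\<rangle>\<close> would
  properly contain \<open>D\<^sup>n\<^sup>m\<langle>x\<rangle>\<close> and hence be normal for every \<open>n\<close>; so \<open>[D, x] \<subseteq> D\<^sup>k\<^sup>m\<close> and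
  \<open>D\<^sup>k \<subseteq> D\<^sup>k\<^sup>m\<close>, a contradiction. Thus \<open>D\<close> is divisible and finitely generated, hence trivial. So
  \<open>A\<close> is central, and the transfer into \<open>A\<close> shows that \<open>[\<gamma>\<^sub>n(G), G]\<close> meets \<open>A\<close> trivially.

  If \<open>G\<close> is infinite and \<open>F = \<gamma>\<^sub>n(G)\<close> is finite, take \<open>z\<close> of infinite order centralizing \<open>F\<close>. For
  a non-nilpotent \<open>E \<le> F\<close> the subgroup \<open>E\<langle>z\<rangle>\<close> properly contains \<open>E\<langle>z\<^sup>2\<rangle>\<close>, so it is normal,
  and so is \<open>E = E\<langle>z\<rangle> \<inter> F\<close>. A minimal non-nilpotent \<open>E \<le> F\<close> is soluble by Schmidt's theorem,
  and \<open>F / E\<close>, all of whose subgroups are normal, is metabelian; thus \<open>G\<close> is soluble.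
\<close>

section \<open>Normalizers and centralizers\<close>

context group
begin

lemma inv_mult_cancel [simp]:
  assumes "x \<in> carrier G" "y \<in> carrier G"
  shows "inv x \<otimes> (x \<otimes> y) = y" "x \<otimes> (inv x \<otimes> y) = y"
  using assms by (simp_all flip: m_assoc)

lemma subgroup_nat_pow_closed:
  assumes "subgroup H G" "h \<in> H"
  shows "h [^] (n::nat) \<in> H"
  using subgroup_int_pow_closed[OF assms, of "int n"] by (simp add: int_pow_int)

lemma conj_hom:
  assumes "g \<in> carrier G"
  shows "group_hom G G (\<lambda>x. g \<otimes> x \<otimes> inv g)"
  using assms by unfold_locales (auto simp: hom_def m_assoc)

lemma conj_eq_image:
  "g <# M #> inv g = (\<lambda>m. g \<otimes> m \<otimes> inv g) ` M"
  by (auto simp: l_coset_def r_coset_def)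

lemma mem_normalizer_iff_image:
  assumes "D \<subseteq> carrier G"
  shows "g \<in> normalizer G D \<longleftrightarrow> g \<in> carrier G \<and> (\<lambda>d. g \<otimes> d \<otimes> inv g) ` D = D"
  using assms by (auto simp: normalizer_def stabilizer_def conj_eq_image)

lemma mem_normalizer_iff:
  assumes "D \<subseteq> carrier G"
  shows "g \<in> normalizer G D
    \<longleftrightarrow> g \<in> carrier G \<and> (\<forall>d \<in> D. g \<otimes> d \<otimes> inv g \<in> D \<and> inv g \<otimes> d \<otimes> g \<in> D)"
proof (cases "g \<in> carrier G")
  case g: True
  have "(\<lambda>d. g \<otimes> d \<otimes> inv g) ` D = D
    \<longleftrightarrow> (\<forall>d \<in> D. g \<otimes> d \<otimes> inv g \<in> D \<and> inv g \<otimes> d \<otimes> g \<in> D)"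
  proof
    assume image: "(\<lambda>d. g \<otimes> d \<otimes> inv g) ` D = D"
    have "g \<otimes> d \<otimes> inv g \<in> D \<and> inv g \<otimes> d \<otimes> g \<in> D" if "d \<in> D" for d
    proof
      show "g \<otimes> d \<otimes> inv g \<in> D" by (rule imageI[OF that, of "\<lambda>d. g \<otimes> d \<otimes> inv g", unfolded image])
      from that have "d \<in> (\<lambda>d. g \<otimes> d \<otimes> inv g) ` D" by (simp only: image)
      then obtain e where e: "e \<in> D" "d = g \<otimes> e \<otimes> inv g" by blast
      moreover have "e \<in> carrier G" using e(1) assms by blast
      ultimately show "inv g \<otimes> d \<otimes> g \<in> D" using g by (simp add: m_assoc)
    qed
    thus "\<forall>d \<in> D. g \<otimes> d \<otimes> inv g \<in> D \<and> inv g \<otimes> d \<otimes> g \<in> D" by blast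
  next
    assume closed: "\<forall>d \<in> D. g \<otimes> d \<otimes> inv g \<in> D \<and> inv g \<otimes> d \<otimes> g \<in> D"
    have "d \<in> (\<lambda>d. g \<otimes> d \<otimes> inv g) ` D" if d: "d \<in> D" for d
    proof (rule image_eqI)
      have "d \<in> carrier G" using d assms by blast
      thus "d = g \<otimes> (inv g \<otimes> d \<otimes> g) \<otimes> inv g" using g by (simp add: m_assoc)
      show "inv g \<otimes> d \<otimes> g \<in> D" using closed d by blast
    qed
    thus "(\<lambda>d. g \<otimes> d \<otimes> inv g) ` D = D" using closed by blast
  qed
  thus ?thesis using mem_normalizer_iff_image[OF assms] by blast
qed (simp add: mem_normalizer_iff_image[OF assms])

lemma normalizer_conj_mem:
  assumes "D \<subseteq> carrier G" "g \<in> normalizer G D" "d \<in> D"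
  shows "g \<otimes> d \<otimes> inv g \<in> D" "inv g \<otimes> d \<otimes> g \<in> D"
  using assms by (simp_all add: mem_normalizer_iff)

lemma normalizer_subset: "D \<subseteq> carrier G \<Longrightarrow> normalizer G D \<subseteq> carrier G"
  by (auto simp: mem_normalizer_iff)

lemma normalizer_singleton_one: "normalizer G {\<one>} = carrier G"
  by (auto simp: mem_normalizer_iff)

lemma subset_normalizer:
  assumes "subgroup D G"
  shows "D \<subseteq> normalizer G D"
proof -
  interpret subgroup D G by fact
  show ?thesis by (auto simp: mem_normalizer_iff[OF subset])
qed

lemma normal_iff_normalizer:
  assumes "subgroup D G"
  shows "D \<lhd> G \<longleftrightarrow> normalizer G D = carrier G"
proof
  assume "D \<lhd> G"
  then interpret normal D G .
  show "normalizer G D = carrier G"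
    by (auto simp: mem_normalizer_iff[OF subset] inv_op_closed1 inv_op_closed2)
next
  assume "normalizer G D = carrier G"
  thus "D \<lhd> G"
    using mem_normalizer_iff[OF subgroup.subset[OF assms]] by (intro normal_invI[OF assms]) blast
qed

section \<open>Commutators\<close>

lemmas word_simps = m_assoc inv_mult_group commutator_def

lemma commutator_closed [simp]:
  "\<lbrakk>x \<in> carrier G; y \<in> carrier G\<rbrakk> \<Longrightarrow> commutator G x y \<in> carrier G"
  by (simp add: commutator_def)

lemma commutator_mem:
  assumes "subgroup H G" "x \<in> H" "y \<in> H"
  shows "commutator G x y \<in> H"
  using assms by (simp add: commutator_def subgroup.m_closed subgroup.m_inv_closed)

lemma inv_commutator:
  "\<lbrakk>x \<in> carrier G; y \<in> carrier G\<rbrakk> \<Longrightarrow> inv (commutator G x y) = commutator G y x"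
  by (simp add: word_simps)

lemma commutator_mem_normalizer:
  assumes "subgroup W G" "w \<in> W" "g \<in> normalizer G W"
  shows "commutator G w g \<in> W" "commutator G g w \<in> W"
proof -
  interpret W: subgroup W G by fact
  have g: "g \<in> carrier G" "inv g \<otimes> w \<otimes> g \<in> W"
    using assms normalizer_subset[OF W.subset] normalizer_conj_mem[OF W.subset] by auto
  have "commutator G w g = inv w \<otimes> (inv g \<otimes> w \<otimes> g)" using assms(2) g by (simp add: word_simps)
  thus "commutator G w g \<in> W" using assms(2) g by simp
  from W.m_inv_closed[OF this] show "commutator G g w \<in> W"
    using assms(2) g(1) by (simp add: inv_commutator)
qed

lemma commutator_eq_one_iff:
  assumes "x \<in> carrier G" "y \<in> carrier G"
  shows "commutator G x y = \<one> \<longleftrightarrow> x \<otimes> y = y \<otimes> x"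
proof -
  have "x \<otimes> y = y \<otimes> x \<otimes> commutator G x y"
    using assms by (simp add: word_simps)
  thus ?thesis
    using assms r_cancel_one[of "y \<otimes> x" "commutator G x y"] by auto
qed

lemma subset_normalizer_if_commutators:
  assumes "subgroup W G" "subgroup H G"
    and commutators: "\<And>w h. \<lbrakk>w \<in> W; h \<in> H\<rbrakk> \<Longrightarrow> commutator G w h \<in> W"
  shows "H \<subseteq> normalizer G W"
proof -
  interpret W: subgroup W G + H: subgroup H G by fact+
  have conj: "inv h \<otimes> w \<otimes> h \<in> W" if "w \<in> W" "h \<in> H" for w h
  proof -
    have "inv h \<otimes> w \<otimes> h = w \<otimes> commutator G w h" using that by (simp add: word_simps)
    thus ?thesis using that commutators by simp
  qed
  have "h \<otimes> w \<otimes> inv h \<in> W" if "w \<in> W" "h \<in> H" for w h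
    using conj[OF that(1) H.m_inv_closed[OF that(2)]] that by simp
  thus ?thesis using conj by (auto simp: mem_normalizer_iff[OF W.subset])
qed

definition centralizer_mod :: "'a set \<Rightarrow> 'a set \<Rightarrow> 'a set" where
  "centralizer_mod W X = {g \<in> normalizer G W. \<forall>x \<in> X. commutator G x g \<in> W}"

abbreviation centralizer :: "'a set \<Rightarrow> 'a set" where
  "centralizer \<equiv> centralizer_mod {\<one>}"

lemma mem_centralizer_iff:
  assumes "X \<subseteq> carrier G"
  shows "g \<in> centralizer X \<longleftrightarrow> g \<in> carrier G \<and> (\<forall>x \<in> X. x \<otimes> g = g \<otimes> x)"
  using assms
  by (auto simp: centralizer_mod_def normalizer_singleton_one commutator_eq_one_iff subset_iff)

lemma centralizer_subset_normalizer:
  assumes "D \<subseteq> carrier G"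
  shows "centralizer D \<subseteq> normalizer G D"
proof
  fix g assume "g \<in> centralizer D"
  hence g: "g \<in> carrier G" "\<And>d. d \<in> D \<Longrightarrow> d \<otimes> g = g \<otimes> d"
    by (auto simp: mem_centralizer_iff[OF assms])
  have "g \<otimes> d \<otimes> inv g = d" "inv g \<otimes> d \<otimes> g = d" if d: "d \<in> D" for d
  proof -
    have d_carrier: "d \<in> carrier G" using d assms by blast
    have "g \<otimes> d \<otimes> inv g = d \<otimes> g \<otimes> inv g" by (simp only: g(2)[OF d])
    thus "g \<otimes> d \<otimes> inv g = d" using g(1) d_carrier by (simp add: m_assoc)
    have "inv g \<otimes> d \<otimes> g = inv g \<otimes> (g \<otimes> d)" using g(1) d_carrier by (simp add: m_assoc g(2)[OF d])
    thus "inv g \<otimes> d \<otimes> g = d" using g(1) d_carrier by simp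
  qed
  thus "g \<in> normalizer G D" using g(1) by (simp add: mem_normalizer_iff[OF assms])
qed

lemma centralizer_mod_subgroup:
  assumes "subgroup W G" "X \<subseteq> carrier G"
  shows "subgroup (centralizer_mod W X) G"
proof -
  interpret W: subgroup W G by fact
  interpret NW: subgroup "normalizer G W" G by (rule normalizer_imp_subgroup[OF W.subset])
  note conj_mem = normalizer_conj_mem[OF W.subset]
  show ?thesis
  proof (rule subgroupI)
    show "centralizer_mod W X \<subseteq> carrier G" by (auto simp: centralizer_mod_def)
    have "commutator G x \<one> = \<one>" if "x \<in> X" for x using that assms(2) by (auto simp: commutator_def)
    hence "\<one> \<in> centralizer_mod W X" by (simp add: centralizer_mod_def)
    thus "centralizer_mod W X \<noteq> {}" by blast
    fix a b assume "a \<in> centralizer_mod W X" "b \<in> centralizer_mod W X"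
    hence a: "a \<in> normalizer G W" "\<And>x. x \<in> X \<Longrightarrow> commutator G x a \<in> W"
      and b: "b \<in> normalizer G W" "\<And>x. x \<in> X \<Longrightarrow> commutator G x b \<in> W"
      by (auto simp: centralizer_mod_def)
    have "commutator G x (a \<otimes> b) \<in> W" if "x \<in> X" for x
    proof -
      have "commutator G x (a \<otimes> b) = commutator G x b \<otimes> (inv b \<otimes> commutator G x a \<otimes> b)"
        using that a(1) b(1) assms(2) by (simp add: word_simps subset_iff)
      thus ?thesis using a(2)[OF that] b(1) b(2)[OF that] conj_mem by simp
    qed
    thus "a \<otimes> b \<in> centralizer_mod W X" using a(1) b(1) by (simp add: centralizer_mod_def)
    have "commutator G x (inv a) \<in> W" if "x \<in> X" for x
    proof -
      have "commutator G x (inv a) = inv (a \<otimes> commutator G x a \<otimes> inv a)"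
        using that a(1) assms(2) by (simp add: word_simps subset_iff)
      thus ?thesis using a(1) a(2)[OF that] conj_mem by simp
    qed
    thus "inv a \<in> centralizer_mod W X" using a(1) by (simp add: centralizer_mod_def)
  qed
qed

lemma generate_subset_centralizer_mod:
  assumes "subgroup W G" "X \<subseteq> carrier G" "Y \<subseteq> normalizer G W"
    and "\<And>x y. \<lbrakk>x \<in> X; y \<in> Y\<rbrakk> \<Longrightarrow> commutator G x y \<in> W"
  shows "generate G Y \<subseteq> centralizer_mod W X"
  using assms
  by (intro generate_subgroup_incl centralizer_mod_subgroup) (auto simp: centralizer_mod_def)

lemma commutator_generate_mem:
  assumes W: "subgroup W G" and X: "X \<subseteq> normalizer G W" and Y: "Y \<subseteq> normalizer G W"
    and commutators: "\<And>x y. \<lbrakk>x \<in> X; y \<in> Y\<rbrakk> \<Longrightarrow> commutator G x y \<in> W"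
    and "x \<in> generate G X" "y \<in> generate G Y"
  shows "commutator G x y \<in> W"
proof -
  have carrier: "X \<subseteq> carrier G" "Y \<subseteq> carrier G"
    using X Y normalizer_subset[OF subgroup.subset[OF W]] by auto
  have gen: "generate G Y \<subseteq> carrier G" by (rule generate_incl[OF carrier(2)])
  have "commutator G y x \<in> W" if "x \<in> X" "y \<in> generate G Y" for x y
  proof -
    have "commutator G x y \<in> W"
      using generate_subset_centralizer_mod[OF W carrier(1) Y commutators] that
      by (auto simp: centralizer_mod_def)
    hence "inv (commutator G x y) \<in> W" by (rule subgroup.m_inv_closed[OF W])
    thus ?thesis using that carrier gen by (simp add: inv_commutator subset_iff)
  qed
  hence "x \<in> centralizer_mod W (generate G Y)"
    using generate_subset_centralizer_mod[OF W gen X] assms(5) by blast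
  hence "inv (commutator G y x) \<in> W"
    using assms(6) subgroup.m_inv_closed[OF W] by (simp add: centralizer_mod_def)
  thus ?thesis
    using assms(5,6) generate_incl[OF carrier(1)] gen by (simp add: inv_commutator subset_iff)
qed

end

definition commutator_subgroup :: "('a, 'b) monoid_scheme \<Rightarrow> 'a set \<Rightarrow> 'a set \<Rightarrow> 'a set" where
  "commutator_subgroup G H K = generate G {commutator G x y | x y. x \<in> H \<and> y \<in> K}"

lemma commutator_mem_commutator_subgroup:
  "\<lbrakk>x \<in> H; y \<in> K\<rbrakk> \<Longrightarrow> commutator G x y \<in> commutator_subgroup G H K"
  unfolding commutator_subgroup_def by (rule generate.incl) blast

context group
begin

lemma commutator_subgroup_subset:
  assumes "subgroup W G" "\<And>x y. \<lbrakk>x \<in> H; y \<in> K\<rbrakk> \<Longrightarrow> commutator G x y \<in> W"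
  shows "commutator_subgroup G H K \<subseteq> W"
  unfolding commutator_subgroup_def using assms(2)
  by (intro generate_subgroup_incl[OF _ assms(1)]) blast

lemma commutator_subgroup_mono:
  "\<lbrakk>H \<subseteq> H'; K \<subseteq> K'\<rbrakk> \<Longrightarrow> commutator_subgroup G H K \<subseteq> commutator_subgroup G H' K'"
  unfolding commutator_subgroup_def by (intro mono_generate) blast

lemma commutator_subgroup_generate_subset:
  assumes "subgroup W G" "X \<subseteq> normalizer G W" "Y \<subseteq> normalizer G W"
    and "\<And>x y. \<lbrakk>x \<in> X; y \<in> Y\<rbrakk> \<Longrightarrow> commutator G x y \<in> W"
  shows "commutator_subgroup G (generate G X) (generate G Y) \<subseteq> W"
  by (rule commutator_subgroup_subset[OF assms(1) commutator_generate_mem[OF assms]])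

lemma commutator_subgroup_is_subgroup:
  assumes "H \<subseteq> carrier G" "K \<subseteq> carrier G"
  shows "subgroup (commutator_subgroup G H K) G"
  unfolding commutator_subgroup_def using assms
  by (intro generate_is_subgroup) (auto intro!: commutator_closed)

lemma derived_eq_commutator_subgroup:
  assumes "subgroup H G"
  shows "derived G H = commutator_subgroup G H H"
proof -
  interpret H: subgroup H G by fact
  have "x \<otimes> y \<otimes> inv x \<otimes> inv y \<in> commutator_subgroup G H H" if "x \<in> H" "y \<in> H" for x y
    using commutator_mem_commutator_subgroup[of "inv x" H "inv y" H G] that
    by (simp add: commutator_def)
  hence "derived G H \<subseteq> commutator_subgroup G H H"
    unfolding derived_def
    by (intro generate_subgroup_incl commutator_subgroup_is_subgroup H.subset) blast
  moreover have "commutator G x y \<in> derived G H" if "x \<in> H" "y \<in> H" for x y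
  proof -
    have "inv x \<otimes> inv y \<otimes> inv (inv x) \<otimes> inv (inv y) \<in> derived_set G H"
      using that H.m_inv_closed by blast
    thus ?thesis
      unfolding derived_def using that by (intro generate.incl) (simp add: commutator_def)
  qed
  hence "commutator_subgroup G H H \<subseteq> derived G H"
    by (intro commutator_subgroup_subset derived_is_subgroup H.subset)
  ultimately show ?thesis by blast
qed

end

context group_hom
begin

lemma commutator_img:
  "\<lbrakk>x \<in> carrier G; y \<in> carrier G\<rbrakk> \<Longrightarrow> h (commutator G x y) = commutator H (h x) (h y)"
  by (simp add: commutator_def)

lemma commutator_subgroup_img:
  assumes "K \<subseteq> carrier G" "L \<subseteq> carrier G"
  shows "commutator_subgroup H (h ` K) (h ` L) = h ` commutator_subgroup G K L"
proof -
  have "{commutator H u v |u v. u \<in> h ` K \<and> v \<in> h ` L}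
      = {commutator H (h x) (h y) |x y. x \<in> K \<and> y \<in> L}" by blast
  also have "\<dots> = {h (commutator G x y) |x y. x \<in> K \<and> y \<in> L}"
    using assms commutator_img by (metis (no_types, opaque_lifting) subsetD)
  also have "\<dots> = h ` {commutator G x y |x y. x \<in> K \<and> y \<in> L}" by blast
  finally have eq: "{commutator H u v |u v. u \<in> h ` K \<and> v \<in> h ` L} = \<dots>" .
  have "{commutator G x y |x y. x \<in> K \<and> y \<in> L} \<subseteq> carrier G"
    using assms by (auto intro!: G.commutator_closed)
  from generate_img[OF this] show ?thesis unfolding commutator_subgroup_def by (simp add: eq)
qed

lemma commute_img_if_commutator_mem_kernel:
  assumes "x \<in> carrier G" "y \<in> carrier G" "commutator G x y \<in> kernel G H h"
  shows "h x \<otimes>\<^bsub>H\<^esub> h y = h y \<otimes>\<^bsub>H\<^esub> h x"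
  using assms by (simp add: kernel_def commutator_img H.commutator_eq_one_iff)

lemma preimage_subgroup:
  assumes "subgroup K H"
  shows "subgroup {x \<in> carrier G. h x \<in> K} G"
proof -
  interpret K: subgroup K H by fact
  show ?thesis by (rule G.subgroupI) (auto intro: exI[of _ \<one>])
qed

lemma preimage_normal:
  assumes "N \<lhd> H"
  shows "{x \<in> carrier G. h x \<in> N} \<lhd> G"
proof (rule G.normal_invI)
  interpret N: normal N H by fact
  show "subgroup {x \<in> carrier G. h x \<in> N} G" by (rule preimage_subgroup[OF N.subgroup_axioms])
  show "g \<otimes> x \<otimes> inv g \<in> {x \<in> carrier G. h x \<in> N}"
    if "g \<in> carrier G" "x \<in> {x \<in> carrier G. h x \<in> N}" for g x
    using that N.inv_op_closed2[of "h g" "h x"] by simp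
qed

lemma image_preimage:
  assumes "h ` carrier G = carrier H" "K \<subseteq> carrier H"
  shows "h ` {x \<in> carrier G. h x \<in> K} = K"
proof -
  have "K \<subseteq> h ` carrier G" by (simp add: assms)
  thus ?thesis by blast
qed

end

context normal
begin

lemma group_hom_Mod: "group_hom G (G Mod H) ((#>) H)"
  by (intro group_hom.intro factorgroup_is_group is_group group_hom_axioms.intro r_coset_hom_Mod)

lemma kernel_Mod: "kernel G (G Mod H) ((#>) H) = H"
  using coset_join1[OF _ _ subgroup_axioms] coset_join2[OF _ subgroup_axioms]
  by (auto simp: kernel_def)

end

section \<open>The lower central series of a subgroup\<close>

primrec lcs_in :: "('a, 'b) monoid_scheme \<Rightarrow> 'a set \<Rightarrow> nat \<Rightarrow> 'a set" where
  "lcs_in G H 0 = H"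
| "lcs_in G H (Suc k) = commutator_subgroup G (lcs_in G H k) H"

lemma lcs_in_carrier: "lcs_in G (carrier G) n = lcs G n"
  by (induction n) (auto simp: commutator_subgroup_def)

context group
begin

lemma lcs_in_mono: "H \<subseteq> K \<Longrightarrow> lcs_in G H n \<subseteq> lcs_in G K n"
  by (induction n) (simp_all add: commutator_subgroup_mono)

lemma lcs_in_subgroup_incl:
  assumes "subgroup H G"
  shows "subgroup (lcs_in G H n) G \<and> lcs_in G H n \<subseteq> H"
proof (induction n)
  case (Suc n)
  hence "commutator_subgroup G (lcs_in G H n) H \<subseteq> H"
    using commutator_mem[OF assms] by (intro commutator_subgroup_subset assms) blast
  thus ?case
    using Suc commutator_subgroup_is_subgroup[OF _ subgroup.subset[OF assms]]
    by (simp add: subgroup.subset)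
qed (use assms in simp)

lemmas lcs_in_subgroup = lcs_in_subgroup_incl[THEN conjunct1]
lemmas lcs_in_subset = lcs_in_subgroup_incl[THEN conjunct2]

lemma lcs_in_subset_carrier:
  "subgroup H G \<Longrightarrow> lcs_in G H n \<subseteq> carrier G"
  using lcs_in_subgroup subgroup.subset by blast

lemma lcs_subgroup_eq:
  assumes "subgroup H G"
  shows "lcs (G\<lparr>carrier := H\<rparr>) n = lcs_in G H n"
proof (induction n)
  case (Suc n)
  have "commutator (G\<lparr>carrier := H\<rparr>) x y = commutator G x y" if "x \<in> H" "y \<in> H" for x y
    using that m_inv_consistent[OF assms] by (simp add: commutator_def)
  hence eq: "{commutator (G\<lparr>carrier := H\<rparr>) x y |x y. x \<in> lcs_in G H n \<and> y \<in> H}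
      = {commutator G x y |x y. x \<in> lcs_in G H n \<and> y \<in> H}"
    using lcs_in_subset[OF assms] by (metis (no_types, lifting) in_mono)
  have "{commutator G x y |x y. x \<in> lcs_in G H n \<and> y \<in> H} \<subseteq> H"
    using lcs_in_subset[OF assms] commutator_mem[OF assms] by blast
  from generate_consistent[OF this assms] show ?case
    by (simp add: Suc eq commutator_subgroup_def)
qed simp

end

lemma (in group_hom) lcs_in_img:
  assumes "subgroup K G"
  shows "lcs_in H (h ` K) n = h ` lcs_in G K n"
  by (induction n)
    (simp_all add: commutator_subgroup_img G.lcs_in_subset_carrier[OF assms]
      subgroup.subset[OF assms])

context group
begin

lemma normalizer_subset_normalizer_lcs_in:
  assumes H: "subgroup H G"
  shows "normalizer G H \<subseteq> normalizer G (lcs_in G H n)"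
proof
  fix g assume "g \<in> normalizer G H"
  hence g: "g \<in> carrier G" "(\<lambda>d. g \<otimes> d \<otimes> inv g) ` H = H"
    by (auto simp: mem_normalizer_iff_image subgroup.subset[OF H])
  interpret group_hom G G "\<lambda>x. g \<otimes> x \<otimes> inv g" by (rule conj_hom[OF g(1)])
  show "g \<in> normalizer G (lcs_in G H n)"
    using lcs_in_img[OF H, of n] g
    by (simp add: mem_normalizer_iff_image lcs_in_subset_carrier[OF H])
qed

lemma lcs_in_normal:
  assumes "N \<lhd> G"
  shows "lcs_in G N n \<lhd> G"
proof -
  interpret normal N G by fact
  have "carrier G \<subseteq> normalizer G (lcs_in G N n)"
    using normalizer_subset_normalizer_lcs_in[OF subgroup_axioms]
      normal_iff_normalizer[OF subgroup_axioms] assms by blast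
  thus ?thesis
    using normal_iff_normalizer[OF lcs_in_subgroup] normalizer_subset lcs_in_subset_carrier
      subgroup_axioms by blast
qed

lemma lcs_normal: "lcs G n \<lhd> G"
  using lcs_in_normal[OF normal_self] by (simp add: lcs_in_carrier)

lemma lcs_in_Suc_subset:
  assumes "subgroup H G"
  shows "lcs_in G H (Suc n) \<subseteq> lcs_in G H n"
proof -
  have "H \<subseteq> normalizer G (lcs_in G H n)"
    using subset_normalizer[OF assms] normalizer_subset_normalizer_lcs_in[OF assms] by blast
  hence "commutator_subgroup G (lcs_in G H n) H \<subseteq> lcs_in G H n"
    by (intro commutator_subgroup_subset lcs_in_subgroup assms
        commutator_mem_normalizer(1)[OF lcs_in_subgroup]) auto
  thus ?thesis by simp
qed

lemma exp_of_derived_subset_lcs_in: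
  assumes "subgroup H G"
  shows "(derived G ^^ n) H \<subseteq> lcs_in G H n"
proof (induction n)
  case (Suc n)
  hence "(derived G ^^ n) H \<subseteq> H" using lcs_in_subset[OF assms] by blast
  thus ?case
    using Suc derived_eq_commutator_subgroup[OF exp_of_derived_is_subgroup[OF assms]]
    by (simp add: commutator_subgroup_mono)
qed simp

lemma nilpotent_subgroup_iff:
  assumes "subgroup H G"
  shows "nilpotent_group (G\<lparr>carrier := H\<rparr>) \<longleftrightarrow> (\<exists>c. lcs_in G H c \<subseteq> {\<one>})"
proof -
  have "lcs_in G H c \<subseteq> {\<one>} \<longleftrightarrow> lcs_in G H c = {\<one>}" for c
    using subgroup.one_closed[OF lcs_in_subgroup[OF assms]] by blast
  thus ?thesis
    using subgroup.subgroup_is_group[OF assms is_group]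
    by (simp add: nilpotent_group_def lcs_subgroup_eq[OF assms])
qed

lemma nilpotent_subgroup_mono:
  assumes "subgroup H G" "subgroup K G" "H \<subseteq> K" "nilpotent_group (G\<lparr>carrier := K\<rparr>)"
  shows "nilpotent_group (G\<lparr>carrier := H\<rparr>)"
proof -
  obtain c where "lcs_in G K c \<subseteq> {\<one>}" using assms nilpotent_subgroup_iff by blast
  hence "lcs_in G H c \<subseteq> {\<one>}" using lcs_in_mono[OF assms(3)] by blast
  thus ?thesis using nilpotent_subgroup_iff[OF assms(1)] by blast
qed

lemma solvable_seq_if_exp_of_derived_subset:
  assumes H: "subgroup H G" and "(derived G ^^ n) H \<subseteq> K" and "solvable_seq G K"
  shows "solvable_seq G H"
proof -
  obtain m where m: "(derived G ^^ m) K = {\<one>}"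
    using solvable_imp_trivial_derived_seq[OF assms(3)] by blast
  have "(derived G ^^ (m + n)) H \<subseteq> {\<one>}"
    using mono_exp_of_derived[OF assms(2), of m] m by (simp add: funpow_add)
  moreover have "\<one> \<in> (derived G ^^ (m + n)) H"
    by (rule subgroup.one_closed[OF exp_of_derived_is_subgroup[OF H]])
  ultimately show ?thesis
    by (intro trivial_derived_seq_imp_solvable[OF H, of "m + n"]) blast
qed

lemma solvable_seq_if_nilpotent:
  assumes "subgroup H G" "nilpotent_group (G\<lparr>carrier := H\<rparr>)"
  shows "solvable_seq G H"
proof -
  obtain c where "lcs_in G H c \<subseteq> {\<one>}" using assms nilpotent_subgroup_iff by blast
  hence "(derived G ^^ c) H \<subseteq> {\<one>}" using exp_of_derived_subset_lcs_in[OF assms(1)] by blast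
  thus ?thesis by (rule solvable_seq_if_exp_of_derived_subset[OF assms(1) _ solvable_seq.unity])
qed

end

lemma (in group_hom) nilpotent_img:
  assumes "subgroup K G" "nilpotent_group (G\<lparr>carrier := K\<rparr>)"
  shows "nilpotent_group (H\<lparr>carrier := h ` K\<rparr>)"
proof -
  obtain c where "lcs_in G K c \<subseteq> {\<one>}" using assms G.nilpotent_subgroup_iff by blast
  hence "lcs_in H (h ` K) c \<subseteq> {\<one>\<^bsub>H\<^esub>}" by (auto simp: lcs_in_img[OF assms(1)])
  thus ?thesis
    using H.nilpotent_subgroup_iff[OF subgroup_img_is_subgroup[OF assms(1)]] by blast
qed

section \<open>Cyclic extensions\<close>

context group
begin

definition cyclic_extension :: "'a set \<Rightarrow> 'a \<Rightarrow> 'a set" where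
  "cyclic_extension E w = {e \<otimes> w [^] (i::int) | e i. e \<in> E}"

lemma cyclic_extension_subgroup:
  assumes E: "subgroup E G" and w: "w \<in> normalizer G E"
  shows "subgroup (cyclic_extension E w) G"
proof -
  interpret E: subgroup E G by fact
  have w_carrier: "w \<in> carrier G" using w normalizer_subset[OF E.subset] by blast
  have conj: "w [^] (i::int) \<otimes> e \<otimes> w [^] (- i) \<in> E" if "e \<in> E" for e i
    using normalizer_conj_mem(1)[OF E.subset subgroup_int_pow_closed[OF normalizer_imp_subgroup w]
      that]
      w_carrier E.subset by (simp add: int_pow_neg)
  show ?thesis
  proof (rule subgroupI)
    show "cyclic_extension E w \<subseteq> carrier G" using w_carrier by (auto simp: cyclic_extension_def)
    show "cyclic_extension E w \<noteq> {}" using E.one_closed unfolding cyclic_extension_def by blast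
    fix a b assume "a \<in> cyclic_extension E w" "b \<in> cyclic_extension E w"
    then obtain u v and i j :: int where a: "u \<in> E" "a = u \<otimes> w [^] i"
      and b: "v \<in> E" "b = v \<otimes> w [^] j" by (auto simp: cyclic_extension_def)
    have "a \<otimes> b = u \<otimes> (w [^] i \<otimes> v \<otimes> w [^] (- i)) \<otimes> w [^] (i + j)"
      using a b w_carrier by (simp add: int_pow_mult int_pow_neg m_assoc)
    thus "a \<otimes> b \<in> cyclic_extension E w"
      using E.m_closed[OF a(1) conj[OF b(1), of i]] unfolding cyclic_extension_def by blast
    have "inv a = (w [^] (- i) \<otimes> inv u \<otimes> w [^] (- (- i))) \<otimes> w [^] (- i)"
      using a w_carrier by (simp add: inv_mult_group int_pow_neg m_assoc)
    thus "inv a \<in> cyclic_extension E w"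
      using conj[OF E.m_inv_closed[OF a(1)], of "- i"] unfolding cyclic_extension_def by blast
  qed
qed

lemma subset_cyclic_extension:
  assumes "E \<subseteq> carrier G"
  shows "E \<subseteq> cyclic_extension E w"
proof
  fix e assume "e \<in> E"
  moreover from this have "e = e \<otimes> w [^] (0::int)" using assms by (simp add: subset_iff)
  ultimately show "e \<in> cyclic_extension E w" unfolding cyclic_extension_def by blast
qed

lemma mem_cyclic_extension:
  assumes "subgroup E G" "w \<in> carrier G"
  shows "w \<in> cyclic_extension E w"
proof -
  have "w = \<one> \<otimes> w [^] (1::int)" using assms(2) by (simp add: int_pow_1)
  thus ?thesis using subgroup.one_closed[OF assms(1)] unfolding cyclic_extension_def by blast
qed

lemma cyclic_extension_mono: "E \<subseteq> F \<Longrightarrow> cyclic_extension E w \<subseteq> cyclic_extension F w"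
  unfolding cyclic_extension_def by blast

lemma cyclic_extension_subset:
  assumes "subgroup F G" "E \<subseteq> F" "w \<in> F"
  shows "cyclic_extension E w \<subseteq> F"
  using assms subgroup_int_pow_closed subgroup.m_closed by (fastforce simp: cyclic_extension_def)

lemma generate_insert_eq_cyclic_extension:
  assumes S: "S \<subseteq> carrier G" and w: "w \<in> normalizer G (generate G S)"
  shows "generate G (insert w S) = cyclic_extension (generate G S) w"
proof
  note gen = generate_is_subgroup[OF S]
  have w_carrier: "w \<in> carrier G" using w normalizer_subset[OF subgroup.subset[OF gen]] by blast
  have "insert w S \<subseteq> cyclic_extension (generate G S) w"
    using mem_cyclic_extension[OF gen w_carrier] subset_cyclic_extension[OF subgroup.subset[OF gen]]
      generate.incl[of _ S G] by blast
  thus "generate G (insert w S) \<subseteq> cyclic_extension (generate G S) w"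
    by (rule generate_subgroup_incl[OF _ cyclic_extension_subgroup[OF gen w]])
  show "cyclic_extension (generate G S) w \<subseteq> generate G (insert w S)"
    using S w_carrier by (intro cyclic_extension_subset generate_is_subgroup mono_generate)
      (auto intro: generate.incl)
qed

lemma cyclic_extension_inter:
  assumes E: "subgroup E G" "E \<subseteq> F" and F: "subgroup F G" and w: "w \<in> carrier G"
    and powers: "\<And>i::int. w [^] i \<in> F \<Longrightarrow> w [^] i = \<one>"
  shows "cyclic_extension E w \<inter> F = E"
proof
  interpret F: subgroup F G by fact
  show "cyclic_extension E w \<inter> F \<subseteq> E"
  proof
    fix f assume f: "f \<in> cyclic_extension E w \<inter> F"
    then obtain e and i :: int where e: "e \<in> E" "f = e \<otimes> w [^] i"
      by (auto simp: cyclic_extension_def)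
    have e_mem: "e \<in> F" using e(1) E(2) by blast
    hence "w [^] i = inv e \<otimes> f" using e(2) w by simp
    hence "w [^] i = \<one>" using powers[of i] e_mem f by simp
    thus "f \<in> E" using e e_mem by simp
  qed
  show "E \<subseteq> cyclic_extension E w \<inter> F"
    using subset_cyclic_extension[OF subgroup.subset[OF E(1)]] E(2) by blast
qed

end

section \<open>Normal overgroups of non-nilpotent subgroups\<close>

context group
begin

text \<open>The only consequence of being para-Nil-Hamiltonian that the proof uses; unlike the
  original property it passes to all quotients.\<close>
definition non_nilpotent_overgroups_normal :: bool where
  "non_nilpotent_overgroups_normal \<longleftrightarrow>
     (\<forall>H K. subgroup H G \<and> subgroup K G \<and> K \<subset> H \<and> \<not> nilpotent_group (G\<lparr>carrier := K\<rparr>)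
        \<longrightarrow> H \<lhd> G)"

lemma non_nilpotent_overgroups_normalD:
  "\<lbrakk>non_nilpotent_overgroups_normal; subgroup H G; subgroup K G; K \<subset> H;
    \<not> nilpotent_group (G\<lparr>carrier := K\<rparr>)\<rbrakk> \<Longrightarrow> H \<lhd> G"
  unfolding non_nilpotent_overgroups_normal_def by blast

lemma para_Nil_Hamiltonian_imp_non_nilpotent_overgroups_normal:
  assumes "para_Nil_Hamiltonian G"
  shows non_nilpotent_overgroups_normal
  unfolding non_nilpotent_overgroups_normal_def
proof (intro allI impI, elim conjE)
  fix H K assume H: "subgroup H G" and K: "subgroup K G" and KH: "K \<subset> H"
    and K_not_nilpotent: "\<not> nilpotent_group (G\<lparr>carrier := K\<rparr>)"
  show "H \<lhd> G"
  proof (rule ccontr)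
    assume "\<not> H \<lhd> G"
    moreover have "\<not> nilpotent_group (G\<lparr>carrier := H\<rparr>)"
      using K_not_nilpotent nilpotent_subgroup_mono[OF K H] KH by blast
    ultimately have "minimal_non_nilpotent (G\<lparr>carrier := H\<rparr>)"
      using assms H by (auto simp: para_Nil_Hamiltonian_def)
    moreover have "subgroup K (G\<lparr>carrier := H\<rparr>)"
      using KH by (intro subgroup_incl K H) blast
    ultimately show False
      using K_not_nilpotent KH by (auto simp: minimal_non_nilpotent_def)
  qed
qed

end

lemma (in group_hom) non_nilpotent_overgroups_normal_img:
  assumes surj: "h ` carrier G = carrier H" and overgroups: "G.non_nilpotent_overgroups_normal"
  shows "H.non_nilpotent_overgroups_normal"
  unfolding H.non_nilpotent_overgroups_normal_def
proof (intro allI impI, elim conjE)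
  fix L K assume L: "subgroup L H" and K: "subgroup K H" and KL: "K \<subset> L"
    and K_not_nilpotent: "\<not> nilpotent_group (H\<lparr>carrier := K\<rparr>)"
  let ?preimage = "\<lambda>K. {x \<in> carrier G. h x \<in> K}"
  note img = image_preimage[OF surj subgroup.subset]
  have "\<not> nilpotent_group (G\<lparr>carrier := ?preimage K\<rparr>)"
    using nilpotent_img[OF preimage_subgroup[OF K]] img[OF K] K_not_nilpotent by auto
  moreover have "?preimage K \<subset> ?preimage L"
  proof
    show "?preimage K \<subseteq> ?preimage L" using KL by blast
    have "h ` ?preimage K \<noteq> h ` ?preimage L"
      unfolding img[OF K] img[OF L] using KL by (rule less_imp_neq)
    thus "?preimage K \<noteq> ?preimage L" by metis
  qed
  ultimately have "?preimage L \<lhd> G"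
    by (rule G.non_nilpotent_overgroups_normalD[OF overgroups preimage_subgroup[OF L]
      preimage_subgroup[OF K],
        rotated])
  from normal.surj_hom_normal_subgroup[OF this group_hom_axioms surj]
  show "L \<lhd> H" by (simp add: img[OF L])
qed

section \<open>Subgroups of finite index\<close>

context group
begin

definition finite_mod :: "'a set \<Rightarrow> 'a set \<Rightarrow> bool" where
  "finite_mod L N \<longleftrightarrow> (\<exists>R. finite R \<and> R \<subseteq> carrier G \<and> L \<subseteq> N <#> R)"

lemma finite_modI:
  assumes L: "L \<subseteq> carrier G" and fin: "finite (f ` L)"
    and fibres: "\<And>a b. \<lbrakk>a \<in> L; b \<in> L; f a = f b\<rbrakk> \<Longrightarrow> a \<otimes> inv b \<in> N"
  shows "finite_mod L N"
proof -
  obtain R where R: "R \<subseteq> L" "finite R" "f ` L = f ` R"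
    using finite_subset_image[OF fin, of f L] by auto
  have "l \<in> N <#> R" if l: "l \<in> L" for l
  proof -
    have "f l \<in> f ` R" using l R(3) by blast
    then obtain r where r: "r \<in> R" "f l = f r" by blast
    hence "l \<otimes> inv r \<in> N" using fibres l R(1) by blast
    moreover have "l = l \<otimes> inv r \<otimes> r" using l r R(1) L by (simp add: m_assoc subset_iff)
    ultimately show ?thesis using r(1) unfolding set_mult_def by blast
  qed
  thus ?thesis using R L unfolding finite_mod_def by blast
qed

lemma finite_mod_refl:
  assumes "N \<subseteq> carrier G"
  shows "finite_mod N N"
  unfolding finite_mod_def using assms
  by (intro exI[of _ "{\<one>}"]) (auto simp: set_mult_def subset_iff)

lemma finite_mod_trans:
  assumes "finite_mod L N" "finite_mod N M" "M \<subseteq> carrier G"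
  shows "finite_mod L M"
proof -
  obtain R where R: "finite R" "R \<subseteq> carrier G" "L \<subseteq> N <#> R"
    using assms(1) unfolding finite_mod_def by blast
  obtain R' where R': "finite R'" "R' \<subseteq> carrier G" "N \<subseteq> M <#> R'"
    using assms(2) unfolding finite_mod_def by blast
  have "N <#> R \<subseteq> M <#> R' <#> R" using R'(3) by (rule mono_set_mult) simp
  hence "L \<subseteq> M <#> (R' <#> R)" using R R' assms(3) by (simp add: set_mult_assoc)
  moreover have "finite (R' <#> R)" using R(1) R'(1) by (simp add: set_mult_def)
  ultimately show ?thesis
    unfolding finite_mod_def using set_mult_closed[OF R'(2) R(2)]
    by (intro exI[of _ "R' <#> R"]) simp
qed

lemma finite_if_finite_mod:
  assumes "finite_mod L N" "finite N"
  shows "finite L"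
proof -
  obtain R where "finite R" "L \<subseteq> N <#> R" using assms(1) unfolding finite_mod_def by blast
  moreover from this assms(2) have "finite (N <#> R)" by (simp add: set_mult_def)
  ultimately show ?thesis using finite_subset by blast
qed

lemma r_coset_eq_iff:
  assumes "subgroup N G" "a \<in> carrier G" "b \<in> carrier G"
  shows "N #> a = N #> b \<longleftrightarrow> a \<otimes> inv b \<in> N"
  using assms by (metis is_group rcos_self repr_independence subgroup.rcos_module)

lemma finite_r_cosets_if_finite_mod:
  assumes "finite_mod L N" "subgroup N G"
  shows "finite ((#>) N ` L)"
proof -
  interpret N: subgroup N G by fact
  obtain R where R: "finite R" "R \<subseteq> carrier G" "L \<subseteq> N <#> R"
    using assms(1) unfolding finite_mod_def by blast
  have "N #> l \<in> (#>) N ` R" if l: "l \<in> L" for l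
  proof -
    obtain n r where nr: "n \<in> N" "r \<in> R" "l = n \<otimes> r"
      using subsetD[OF R(3) l] by (auto simp: set_mult_def)
    moreover have "r \<in> carrier G" using nr(2) R(2) by blast
    ultimately have "N #> l = N #> r"
      by (simp add: r_coset_eq_iff[OF N.subgroup_axioms] m_assoc)
    thus ?thesis using nr(2) by blast
  qed
  hence "(#>) N ` L \<subseteq> (#>) N ` R" by (rule image_subsetI)
  thus ?thesis by (rule finite_subset) (simp add: R(1))
qed

lemma finite_if_finite_mod_inter_trivial:
  assumes fin: "finite_mod L N" and N: "subgroup N G"
    and T: "subgroup T G" "T \<subseteq> L" "T \<inter> N \<subseteq> {\<one>}"
  shows "finite T"
proof (rule finite_imageD)
  interpret T: subgroup T G by fact
  show "finite ((#>) N ` T)"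
    by (rule finite_subset[OF image_mono[OF T(2)] finite_r_cosets_if_finite_mod[OF fin N]])
  show "inj_on ((#>) N) T"
  proof (rule inj_onI)
    fix a b assume ab: "a \<in> T" "b \<in> T" "N #> a = N #> b"
    hence "a \<otimes> inv b \<in> T \<inter> N" by (simp add: r_coset_eq_iff[OF N])
    hence "a \<otimes> inv b = \<one>" using T(3) by blast
    thus "a = b" using ab(1,2) by (metis T.mem_carrier inv_closed inv_equality inv_inv)
  qed
qed

lemma finite_mod_pow_mem:
  assumes fin: "finite_mod L N" and N: "subgroup N G" and L: "subgroup L G" and x: "x \<in> L"
  obtains k :: nat where "k > 0" "x [^] k \<in> N"
proof -
  interpret L: subgroup L G by fact
  have "range (\<lambda>i::nat. N #> x [^] i) \<subseteq> (#>) N ` L"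
    using subgroup_nat_pow_closed[OF L x] by blast
  hence "finite (range (\<lambda>i::nat. N #> x [^] i))"
    using finite_r_cosets_if_finite_mod[OF fin N] by (rule finite_subset)
  hence "\<not> inj (\<lambda>i::nat. N #> x [^] i)" using finite_imageD infinite_UNIV_nat by blast
  then obtain i j :: nat where ij: "i < j" "N #> x [^] i = N #> x [^] j"
    using linorder_injI[of "\<lambda>i::nat. N #> x [^] i"] by blast
  have "x [^] (j - i) \<otimes> x [^] i = x [^] j" using x ij(1) by (simp add: nat_pow_mult)
  hence "x [^] (j - i) = x [^] j \<otimes> inv (x [^] i)"
    using x by (metis L.mem_carrier inv_solve_right nat_pow_closed)
  hence "x [^] (j - i) \<in> N" using ij(2)[symmetric] x by (simp add: r_coset_eq_iff[OF N])
  thus ?thesis using that[of "j - i"] ij(1) by simp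
qed

lemma finite_mod_cyclic_extension:
  assumes E: "subgroup E G" and w: "w \<in> carrier G" and q: "(q::nat) > 0" "w [^] q \<in> E"
  shows "finite_mod (cyclic_extension E w) E"
proof -
  interpret E: subgroup E G by fact
  let ?R = "(\<lambda>i::nat. w [^] i) ` {..<q}"
  have "x \<in> E <#> ?R" if x: "x \<in> cyclic_extension E w" for x
  proof -
    from x obtain e and i :: int where e: "e \<in> E" "x = e \<otimes> w [^] i"
      by (auto simp: cyclic_extension_def)
    define r where "r = nat (i mod int q)"
    have r: "i = int q * (i div int q) + int r" "r < q"
      using q(1) by (simp_all add: r_def nat_less_iff)
    have "w [^] i = (w [^] q) [^] (i div int q) \<otimes> w [^] r"
      by (subst r(1)) (use w in \<open>simp add: int_pow_mult flip: int_pow_pow int_pow_int\<close>)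
    hence "x = (e \<otimes> (w [^] q) [^] (i div int q)) \<otimes> w [^] r" using e w by (simp add: m_assoc)
    moreover have "e \<otimes> (w [^] q) [^] (i div int q) \<in> E"
      using e(1) subgroup_int_pow_closed[OF E q(2)] by simp
    ultimately show ?thesis using r(2) unfolding set_mult_def by blast
  qed
  thus ?thesis using w unfolding finite_mod_def by (intro exI[of _ ?R]) auto
qed

definition normal_core :: "'a set \<Rightarrow> 'a set" where
  "normal_core H = {n \<in> carrier G. \<forall>g \<in> carrier G. g \<otimes> n \<otimes> inv g \<in> H}"

lemma normal_core_subset: "normal_core H \<subseteq> H"
proof
  fix n assume "n \<in> normal_core H"
  hence "n \<in> carrier G" "\<one> \<otimes> n \<otimes> inv \<one> \<in> H" unfolding normal_core_def by blast+
  thus "n \<in> H" by simp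
qed

lemma normal_core_subgroup:
  assumes "subgroup H G"
  shows "subgroup (normal_core H) G"
proof (rule subgroupI)
  interpret H: subgroup H G by fact
  show "normal_core H \<subseteq> carrier G" by (auto simp: normal_core_def)
  have "\<one> \<in> normal_core H" by (simp add: normal_core_def)
  thus "normal_core H \<noteq> {}" by blast
  fix a b assume "a \<in> normal_core H" "b \<in> normal_core H"
  hence a: "a \<in> carrier G" "\<And>g. g \<in> carrier G \<Longrightarrow> g \<otimes> a \<otimes> inv g \<in> H"
    and b: "b \<in> carrier G" "\<And>g. g \<in> carrier G \<Longrightarrow> g \<otimes> b \<otimes> inv g \<in> H"
    by (auto simp: normal_core_def)
  have "g \<otimes> inv a \<otimes> inv g \<in> H" if "g \<in> carrier G" for g
  proof -
    have "g \<otimes> inv a \<otimes> inv g = inv (g \<otimes> a \<otimes> inv g)"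
      using a(1) that by (simp add: inv_mult_group m_assoc)
    thus ?thesis using a(2)[OF that] by simp
  qed
  thus "inv a \<in> normal_core H" using a(1) by (simp add: normal_core_def)
  have "g \<otimes> (a \<otimes> b) \<otimes> inv g \<in> H" if "g \<in> carrier G" for g
  proof -
    have "g \<otimes> (a \<otimes> b) \<otimes> inv g = (g \<otimes> a \<otimes> inv g) \<otimes> (g \<otimes> b \<otimes> inv g)"
      using a(1) b(1) that by (simp add: m_assoc)
    thus ?thesis using a(2)[OF that] b(2)[OF that] by simp
  qed
  thus "a \<otimes> b \<in> normal_core H" using a(1) b(1) by (simp add: normal_core_def)
qed

lemma normal_core_normal:
  assumes "subgroup H G"
  shows "normal_core H \<lhd> G"
proof (rule normal_invI[OF normal_core_subgroup[OF assms]])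
  fix x n assume x: "x \<in> carrier G" and n: "n \<in> normal_core H"
  have "g \<otimes> (x \<otimes> n \<otimes> inv x) \<otimes> inv g \<in> H" if "g \<in> carrier G" for g
  proof -
    have "g \<otimes> (x \<otimes> n \<otimes> inv x) \<otimes> inv g = (g \<otimes> x) \<otimes> n \<otimes> inv (g \<otimes> x)"
      using x n that by (simp add: normal_core_def inv_mult_group m_assoc)
    thus ?thesis using n x that by (simp add: normal_core_def)
  qed
  thus "x \<otimes> n \<otimes> inv x \<in> normal_core H" using x n by (simp add: normal_core_def)
qed

lemma finite_mod_normal_core:
  assumes H: "subgroup H G" and fin: "finite (rcosets H)"
  shows "finite_mod (carrier G) (normal_core H)"
proof (rule finite_modI[where f = "\<lambda>a. \<lambda>c \<in> rcosets H. c #> a"])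
  interpret H: subgroup H G by fact
  have "c #> a \<in> rcosets H" if "c \<in> rcosets H" "a \<in> carrier G" for c a
    using that by (auto simp: RCOSETS_def coset_mult_assoc[OF H.subset])
  hence "(\<lambda>a. \<lambda>c \<in> rcosets H. c #> a) ` carrier G \<subseteq> rcosets H \<rightarrow>\<^sub>E rcosets H" by auto
  thus "finite ((\<lambda>a. \<lambda>c \<in> rcosets H. c #> a) ` carrier G)"
    using finite_PiE[of "rcosets H" "\<lambda>_. rcosets H"] fin finite_subset by blast
  fix a b assume ab: "a \<in> carrier G" "b \<in> carrier G"
    and eq: "(\<lambda>c \<in> rcosets H. c #> a) = (\<lambda>c \<in> rcosets H. c #> b)"
  have "g \<otimes> (a \<otimes> inv b) \<otimes> inv g \<in> H" if g: "g \<in> carrier G" for g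
  proof -
    have "H #> g \<in> rcosets H" by (rule rcosetsI[OF H.subset g])
    with fun_cong[OF eq, of "H #> g"] have "H #> (g \<otimes> a) = H #> (g \<otimes> b)"
      using g ab by (simp add: coset_mult_assoc[OF H.subset])
    thus ?thesis using g ab by (simp add: r_coset_eq_iff[OF H] inv_mult_group m_assoc)
  qed
  thus "a \<otimes> inv b \<in> normal_core H" using ab by (simp add: normal_core_def)
qed simp

lemma finite_mod_centralizer:
  assumes "F \<lhd> G" "finite F"
  shows "finite_mod (carrier G) (centralizer F)"
proof (rule finite_modI[where f = "\<lambda>g. \<lambda>f \<in> F. inv g \<otimes> f \<otimes> g"])
  interpret F: normal F G by fact
  have "(\<lambda>g. \<lambda>f \<in> F. inv g \<otimes> f \<otimes> g) ` carrier G \<subseteq> F \<rightarrow>\<^sub>E F"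
    using F.inv_op_closed1 by auto
  thus "finite ((\<lambda>g. \<lambda>f \<in> F. inv g \<otimes> f \<otimes> g) ` carrier G)"
    using finite_PiE[of F "\<lambda>_. F"] assms(2) finite_subset by blast
  fix a b assume ab: "a \<in> carrier G" "b \<in> carrier G"
    and eq: "(\<lambda>f \<in> F. inv a \<otimes> f \<otimes> a) = (\<lambda>f \<in> F. inv b \<otimes> f \<otimes> b)"
  have "f \<otimes> (a \<otimes> inv b) = (a \<otimes> inv b) \<otimes> f" if f: "f \<in> F" for f
  proof -
    have "f \<otimes> (a \<otimes> inv b) = a \<otimes> (inv a \<otimes> f \<otimes> a) \<otimes> inv b" using ab f by (simp add: m_assoc)
    also have "inv a \<otimes> f \<otimes> a = inv b \<otimes> f \<otimes> b" using fun_cong[OF eq, of f] f by simp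
    also have "a \<otimes> (inv b \<otimes> f \<otimes> b) \<otimes> inv b = (a \<otimes> inv b) \<otimes> f" using ab f by (simp add: m_assoc)
    finally show ?thesis .
  qed
  thus "a \<otimes> inv b \<in> centralizer F" using ab by (simp add: mem_centralizer_iff[OF F.subset])
qed simp

end

lemma (in group_hom) finite_mod_img:
  assumes "G.finite_mod L N" "N \<subseteq> carrier G"
  shows "H.finite_mod (h ` L) (h ` N)"
proof -
  obtain R where R: "finite R" "R \<subseteq> carrier G" "L \<subseteq> N <#> R"
    using assms(1) unfolding G.finite_mod_def by blast
  have "h ` L \<subseteq> h ` N <#>\<^bsub>H\<^esub> h ` R"
    using set_mult_hom[OF homh assms(2) R(2)] image_mono[OF R(3), of h] by simp
  thus ?thesis using R(1,2) unfolding H.finite_mod_def by (intro exI[of _ "h ` R"]) auto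
qed

lemma (in group_hom) finite_mod_kernel:
  assumes "L \<subseteq> carrier G" "finite (h ` L)"
  shows "G.finite_mod L (kernel G H h)"
  using assms by (intro G.finite_modI[where f = h]) (auto simp: kernel_def subset_iff)

section \<open>Finitely generated groups\<close>

context group
begin

definition finitely_generated_over :: "'a set \<Rightarrow> 'a set \<Rightarrow> bool" where
  "finitely_generated_over B A \<longleftrightarrow> (\<exists>S. finite S \<and> S \<subseteq> A \<and> generate G (S \<union> B) = A)"

abbreviation finitely_generated :: "'a set \<Rightarrow> bool" where
  "finitely_generated \<equiv> finitely_generated_over {}"

lemma generate_subset_if_mult_closed:
  assumes "S \<subseteq> carrier G" "U \<subseteq> carrier G" "\<one> \<in> U"
    and closed: "\<And>u s. \<lbrakk>u \<in> U; s \<in> S \<union> m_inv G ` S\<rbrakk> \<Longrightarrow> u \<otimes> s \<in> U"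
  shows "generate G S \<subseteq> U"
proof
  fix g assume "g \<in> generate G S"
  hence "\<forall>u \<in> U. u \<otimes> g \<in> U"
  proof induction
    case one
    thus ?case using assms(2) by (simp add: subset_iff)
  next
    case (eng g h)
    have "g \<in> carrier G" "h \<in> carrier G"
      using eng.hyps generate_in_carrier[OF assms(1)] by auto
    thus ?case using eng.IH assms(2) by (simp add: subset_iff flip: m_assoc)
  qed (simp_all add: closed)
  hence "\<one> \<otimes> g \<in> U" using assms(3) by blast
  thus "g \<in> U" using generate_in_carrier[OF assms(1)] \<open>g \<in> generate G S\<close> by simp
qed

lemma generate_set_mult_transversal:
  assumes S: "S \<subseteq> carrier G" and T: "T \<subseteq> carrier G" and R: "R \<subseteq> carrier G" "\<one> \<in> R"
    and rewrite: "\<And>r s. \<lbrakk>r \<in> R; s \<in> S \<union> m_inv G ` S\<rbrakk> \<Longrightarrow> \<exists>t \<in> T. \<exists>r' \<in> R. r \<otimes> s = t \<otimes> r'"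
  shows "generate G S \<subseteq> generate G T <#> R"
proof (rule generate_subset_if_mult_closed[OF S])
  interpret gen: subgroup "generate G T" G by (rule generate_is_subgroup[OF T])
  show "generate G T <#> R \<subseteq> carrier G" by (rule set_mult_closed[OF gen.subset R(1)])
  have "\<one> \<otimes> \<one> \<in> generate G T <#> R" using gen.one_closed R(2) unfolding set_mult_def by blast
  thus "\<one> \<in> generate G T <#> R" by simp
  fix u s assume "u \<in> generate G T <#> R" and s: "s \<in> S \<union> m_inv G ` S"
  then obtain w r where u: "w \<in> generate G T" "r \<in> R" "u = w \<otimes> r" by (auto simp: set_mult_def)
  obtain t r' where t: "t \<in> T" "r' \<in> R" "r \<otimes> s = t \<otimes> r'" using rewrite[OF u(2) s] by blast
  have "s \<in> carrier G" "r \<in> carrier G" "t \<in> carrier G" "r' \<in> carrier G"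
    using s S T R(1) u(2) t(1,2) by auto
  hence "u \<otimes> s = (w \<otimes> t) \<otimes> r'" using u(1,3) t(3) by (simp add: m_assoc)
  thus "u \<otimes> s \<in> generate G T <#> R"
    using u(1) t(1,2) gen.m_closed generate.incl[of t T G] unfolding set_mult_def by blast
qed

lemma finitely_generated_if_finite_mod:
  assumes fg: "finitely_generated (carrier G)" and N: "subgroup N G"
    and fin: "finite_mod (carrier G) N"
  shows "finitely_generated N"
proof -
  interpret N: subgroup N G by fact
  obtain S where S: "finite S" "S \<subseteq> carrier G" "generate G S = carrier G"
    using fg by (auto simp: finitely_generated_over_def)
  obtain R0 where R0: "finite R0" "R0 \<subseteq> carrier G" "carrier G \<subseteq> N <#> R0"
    using fin unfolding finite_mod_def by blast
  define R where "R = insert \<one> R0"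
  have R: "finite R" "R \<subseteq> carrier G" "\<one> \<in> R" using R0 by (auto simp: R_def)
  define S' where "S' = S \<union> m_inv G ` S"
  define T where "T = ((\<lambda>(r, s, r'). r \<otimes> s \<otimes> inv r') ` (R \<times> S' \<times> R) \<union> R) \<inter> N"
  have T: "finite T" "T \<subseteq> N" using R(1) S(1) by (auto simp: T_def S'_def)
  have gen_N: "generate G T \<subseteq> N" by (rule generate_subgroup_incl[OF T(2) N])
  have "generate G S \<subseteq> generate G T <#> R"
  proof (rule generate_set_mult_transversal[OF S(2) _ R(2,3)])
    show "T \<subseteq> carrier G" using T(2) N.subset by (rule subset_trans)
    fix r s assume r: "r \<in> R" and s: "s \<in> S \<union> m_inv G ` S"
    have "r \<otimes> s \<in> carrier G" using r s R(2) S(2) by auto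
    then obtain n r' where n: "n \<in> N" "r' \<in> R" "r \<otimes> s = n \<otimes> r'"
      using R0(3) by (force simp: set_mult_def R_def)
    have "r' \<in> carrier G" using n(2) R(2) by blast
    hence "n = r \<otimes> s \<otimes> inv r'" using n by (simp add: m_assoc)
    hence "n \<in> T" using n(1,2) r s unfolding T_def S'_def by force
    thus "\<exists>t \<in> T. \<exists>r' \<in> R. r \<otimes> s = t \<otimes> r'" using n(2,3) by blast
  qed
  hence cover: "carrier G \<subseteq> generate G T <#> R" by (simp only: S(3))
  have "N \<subseteq> generate G T"
  proof
    fix n assume n: "n \<in> N"
    then obtain t r where tr: "t \<in> generate G T" "r \<in> R" "n = t \<otimes> r"
      using subsetD[OF cover N.mem_carrier[OF n]] by (auto simp: set_mult_def)
    have t_mem: "t \<in> N" using tr(1) gen_N by blast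
    hence "r = inv t \<otimes> n" using tr(3) subsetD[OF R(2) tr(2)] by simp
    hence "r \<in> T" using t_mem n tr(2) by (simp add: T_def)
    thus "n \<in> generate G T" using tr(1,3) by (simp add: generate.incl generate.eng)
  qed
  hence "generate G (T \<union> {}) = N" using gen_N by simp
  thus ?thesis unfolding finitely_generated_over_def using T by blast
qed

lemma finitely_generated_over_if_finitely_generated:
  assumes "subgroup A G" "finitely_generated A" "B \<subseteq> A"
  shows "finitely_generated_over B A"
proof -
  obtain S where S: "finite S" "S \<subseteq> A" "generate G S = A"
    using assms(2) by (auto simp: finitely_generated_over_def)
  have "generate G (S \<union> B) \<subseteq> A"
    using S(2) assms(3) by (intro generate_subgroup_incl[OF _ assms(1)]) simp
  moreover have "A \<subseteq> generate G (S \<union> B)" using mono_generate[of S "S \<union> B"] S(3) by simp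
  ultimately show ?thesis unfolding finitely_generated_over_def using S by blast
qed

lemma finitely_generated_over_commutator_subgroup:
  assumes A: "subgroup A G" "A \<subseteq> H" and H: "subgroup H G" "finitely_generated H"
    and fg: "finitely_generated_over B A"
    and B: "commutator_subgroup G A H \<subseteq> B" "B \<subseteq> A"
  shows "finitely_generated_over (commutator_subgroup G B H) (commutator_subgroup G A H)"
proof -
  interpret H: subgroup H G by (rule H(1))
  let ?C = "commutator_subgroup G A H" and ?D = "commutator_subgroup G B H"
  obtain S where S: "finite S" "S \<subseteq> A" "generate G (S \<union> B) = A"
    using fg unfolding finitely_generated_over_def by blast
  obtain X where X: "finite X" "X \<subseteq> H" "generate G X = H"
    using H(2) by (auto simp: finitely_generated_over_def)
  define K where "K = (\<lambda>(s, x). commutator G s x) ` (S \<times> X)"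
  have K: "finite K" "K \<subseteq> ?C"
    using S(1,2) X(1,2) by (auto simp: K_def intro!: commutator_mem_commutator_subgroup)
  define W where "W = generate G (K \<union> ?D)"
  have C: "subgroup ?C G"
    by (rule commutator_subgroup_is_subgroup[OF subgroup.subset[OF A(1)] H.subset])
  have gens: "K \<union> ?D \<subseteq> ?C" using K(2) commutator_subgroup_mono[OF B(2) subset_refl] by simp
  have W_subset: "W \<subseteq> ?C" unfolding W_def by (rule generate_subgroup_incl[OF gens C])
  have W: "subgroup W G"
    unfolding W_def by (rule generate_is_subgroup[OF subset_trans[OF gens subgroup.subset[OF C]]])
  have K_subset: "K \<subseteq> W" and D_subset_W: "?D \<subseteq> W"
    unfolding W_def using generate.incl[of _ "K \<union> ?D" G] by auto
  have commutator_mem_W: "commutator G b h \<in> W" if "b \<in> B" "h \<in> H" for b h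
    using commutator_mem_commutator_subgroup[OF that] D_subset_W by blast
  have H_normalizes: "H \<subseteq> normalizer G W"
    using W_subset B(1) commutator_mem_W by (intro subset_normalizer_if_commutators W H(1)) blast
  have "commutator_subgroup G (generate G (S \<union> B)) (generate G X) \<subseteq> W"
  proof (rule commutator_subgroup_generate_subset[OF W])
    have "S \<union> B \<subseteq> H" using S(2) A(2) B(2) by blast
    thus "S \<union> B \<subseteq> normalizer G W" using H_normalizes by (rule subset_trans)
    show "X \<subseteq> normalizer G W" using X(2) H_normalizes by (rule subset_trans)
    show "commutator G s x \<in> W" if "s \<in> S \<union> B" "x \<in> X" for s x
      using that commutator_mem_W[of s x] X(2) K_subset by (auto simp: K_def)
  qed
  hence "?C \<subseteq> W" by (simp only: S(3) X(3))
  thus ?thesis unfolding finitely_generated_over_def using K W_subset W_def by blast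
qed

lemma finitely_generated_over_lcs_in_Suc:
  assumes H: "subgroup H G" and fg: "finitely_generated H"
  shows "finitely_generated_over (lcs_in G H (Suc n)) (lcs_in G H n)"
proof (induction n)
  case 0
  show ?case
    using finitely_generated_over_if_finitely_generated[OF H fg lcs_in_subset[OF H, of "Suc 0"]]
    by simp
next
  case (Suc n)
  show ?case
    using finitely_generated_over_commutator_subgroup[OF lcs_in_subgroup[OF H] lcs_in_subset[OF H]
      H fg Suc]
      lcs_in_Suc_subset[OF H, of n] by simp
qed

lemma finite_mod_if_torsion_mod:
  assumes A: "subgroup A G" and B: "subgroup B G" "B \<subseteq> A"
    and abelian_mod: "\<And>a b. \<lbrakk>a \<in> A; b \<in> A\<rbrakk> \<Longrightarrow> commutator G a b \<in> B"
    and fg: "finitely_generated_over B A"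
    and torsion_mod: "\<And>a. a \<in> A \<Longrightarrow> \<exists>q::nat > 0. a [^] q \<in> B"
  shows "finite_mod A B"
proof -
  interpret A: subgroup A G + B: subgroup B G by fact+
  have "finite_mod (generate G (S \<union> B)) B" if "finite S" "S \<subseteq> A" for S
    using that
  proof (induction S rule: finite_induct)
    case empty
    have "generate G B = B" by (rule generateI[OF B(1), symmetric]) auto
    thus ?case using finite_mod_refl[OF B.subset] by simp
  next
    case (insert b S)
    let ?E = "generate G (S \<union> B)"
    have b: "b \<in> A" and gens_subset: "S \<union> B \<subseteq> A" using insert.prems B(2) by auto
    have gens_carrier: "S \<union> B \<subseteq> carrier G" using gens_subset A.subset by (rule subset_trans)
    have E: "subgroup ?E G" by (rule generate_is_subgroup[OF gens_carrier])
    have E_subset: "?E \<subseteq> A" by (rule generate_subgroup_incl[OF gens_subset A])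
    have B_subset: "B \<subseteq> ?E" using generate.incl[of _ "S \<union> B" G] by blast
    have "A \<subseteq> normalizer G ?E"
      using abelian_mod E_subset B_subset by (intro subset_normalizer_if_commutators E A) blast
    hence "generate G (insert b S \<union> B) = cyclic_extension ?E b"
      using b generate_insert_eq_cyclic_extension[OF gens_carrier, of b] by auto
    moreover obtain q :: nat where "q > 0" "b [^] q \<in> B" using torsion_mod[OF b] by blast
    ultimately have "finite_mod (generate G (insert b S \<union> B)) ?E"
      using finite_mod_cyclic_extension[OF E A.mem_carrier[OF b]] B_subset by auto
    moreover have "finite_mod ?E B" using insert by simp
    ultimately show ?case using B.subset by (rule finite_mod_trans)
  qed
  thus ?thesis using fg unfolding finitely_generated_over_def by metis
qed

lemma nilpotent_torsion_finite:
  assumes H: "subgroup H G" and fg: "finitely_generated H"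
    and nilpotent: "nilpotent_group (G\<lparr>carrier := H\<rparr>)"
    and torsion: "\<And>a. a \<in> H \<Longrightarrow> ord a \<noteq> 0"
  shows "finite H"
proof -
  interpret H: subgroup H G by fact
  note lcs = lcs_in_subgroup[OF H]
  have "finite_mod H (lcs_in G H i)" for i
  proof (induction i)
    case 0
    show ?case by (simp add: finite_mod_refl[OF H.subset])
  next
    case (Suc i)
    have "finite_mod (lcs_in G H i) (lcs_in G H (Suc i))"
    proof (rule finite_mod_if_torsion_mod[OF lcs lcs lcs_in_Suc_subset[OF H]])
      show "finitely_generated_over (lcs_in G H (Suc i)) (lcs_in G H i)"
        by (rule finitely_generated_over_lcs_in_Suc[OF H fg])
      show "commutator G a b \<in> lcs_in G H (Suc i)" if "a \<in> lcs_in G H i" "b \<in> lcs_in G H i" for a b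
        using that lcs_in_subset[OF H, of i] by (auto intro!: commutator_mem_commutator_subgroup)
      show "\<exists>q::nat > 0. a [^] q \<in> lcs_in G H (Suc i)" if "a \<in> lcs_in G H i" for a
      proof -
        have "a \<in> H" using that lcs_in_subset[OF H] by blast
        thus ?thesis
          using torsion[of a] subgroup.one_closed[OF lcs, of "Suc i"]
          by (intro exI[of _ "ord a"]) simp
      qed
    qed
    with Suc show ?case using lcs_in_subset_carrier[OF H] by (rule finite_mod_trans)
  qed
  moreover obtain c where "lcs_in G H c \<subseteq> {\<one>}" using nilpotent nilpotent_subgroup_iff[OF H] by blast
  ultimately show ?thesis
    using finite_if_finite_mod finite_subset by (metis finite.emptyI finite.insertI)
qed

end

section \<open>Abelian subgroups\<close>

definition (in group) torsion_free :: "'a set \<Rightarrow> bool" where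
  "torsion_free A \<longleftrightarrow> (\<forall>a \<in> A. ord a \<noteq> 0 \<longrightarrow> a = \<one>)"

definition (in group) divisible :: "'a set \<Rightarrow> bool" where
  "divisible A \<longleftrightarrow> (\<forall>a \<in> A. \<forall>m::nat > 0. \<exists>b \<in> A. b [^] m = a)"

definition (in group) powers :: "'a set \<Rightarrow> nat \<Rightarrow> 'a set" where
  "powers A m = (\<lambda>a. a [^] m) ` A"

context group
begin

lemma torsion_freeD:
  assumes "torsion_free A" "A \<subseteq> carrier G" "a \<in> A" "a [^] (q::nat) = \<one>" "q > 0"
  shows "a = \<one>"
proof -
  have "a \<in> carrier G" using assms(2,3) by blast
  hence "ord a dvd q" using assms(4) by (simp add: pow_eq_id)
  thus ?thesis using assms(1,3,5) by (auto simp: torsion_free_def)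
qed

lemma int_pow_mem_imp_abs_pow_mem:
  assumes "subgroup C G" "a \<in> carrier G" "a [^] (i :: int) \<in> C"
  shows "a [^] nat \<bar>i\<bar> \<in> C"
proof -
  have "a [^] int (nat \<bar>i\<bar>) \<in> C"
    using assms subgroup.m_inv_closed[OF assms(1) assms(3)]
    by (cases "i \<ge> 0") (auto simp: int_pow_neg)
  thus ?thesis by (simp add: int_pow_int)
qed

end

locale abelian_subgroup = group + subgroup A G for A +
  assumes comm: "\<lbrakk>a \<in> A; b \<in> A\<rbrakk> \<Longrightarrow> a \<otimes> b = b \<otimes> a"
begin

sublocale subgroup_group: comm_group "G\<lparr>carrier := A\<rparr>"
  by (rule group.group_comm_groupI[OF subgroup_is_group[OF is_group]]) (simp add: comm)

lemma abelian_subgroup_subset: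
  assumes "subgroup B G" "B \<subseteq> A"
  shows "abelian_subgroup G B"
proof -
  interpret B: subgroup B G by fact
  show ?thesis by unfold_locales (use assms(2) comm in auto)
qed

lemma nat_pow_distrib: "\<lbrakk>a \<in> A; b \<in> A\<rbrakk> \<Longrightarrow> (a \<otimes> b) [^] (m::nat) = a [^] m \<otimes> b [^] m"
  by (intro pow_mult_distrib comm) auto

lemma int_pow_distrib: "\<lbrakk>a \<in> A; b \<in> A\<rbrakk> \<Longrightarrow> (a \<otimes> b) [^] (i::int) = a [^] i \<otimes> b [^] i"
  by (intro int_pow_mult_distrib comm) auto

lemma nat_pow_hom: "group_hom (G\<lparr>carrier := A\<rparr>) G (\<lambda>a. a [^] (m::nat))"
  by unfold_locales (auto intro!: homI nat_pow_distrib)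

lemma powers_subset: "powers A m \<subseteq> A"
  using subgroup_nat_pow_closed[OF subgroup_axioms] by (auto simp: powers_def)

lemma powers_mult_subset: "powers A (m * n) \<subseteq> powers A m"
proof
  fix b assume "b \<in> powers A (m * n)"
  then obtain a where a: "a \<in> A" "b = a [^] (m * n)" by (auto simp: powers_def)
  have "b = (a [^] n) [^] m" using a by (simp add: nat_pow_pow mult.commute)
  thus "b \<in> powers A m"
    using subgroup_nat_pow_closed[OF subgroup_axioms a(1)] by (simp add: powers_def)
qed

lemma powers_subgroup: "subgroup (powers A m) G"
  using group_hom.img_is_subgroup[OF nat_pow_hom] by (simp add: powers_def)

lemma normalizer_subset_normalizer_powers: "normalizer G A \<subseteq> normalizer G (powers A m)"
proof
  fix g assume "g \<in> normalizer G A"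
  hence g: "g \<in> carrier G" "(\<lambda>a. g \<otimes> a \<otimes> inv g) ` A = A"
    by (auto simp: mem_normalizer_iff_image[OF subset])
  interpret conj: group_hom G G "\<lambda>x. g \<otimes> x \<otimes> inv g" by (rule conj_hom[OF g(1)])
  have "(\<lambda>a. g \<otimes> a \<otimes> inv g) ` powers A m = (\<lambda>a. (g \<otimes> a \<otimes> inv g) [^] m) ` A"
    unfolding powers_def image_image by (intro image_cong refl conj.hom_nat_pow mem_carrier)
  also have "\<dots> = (\<lambda>a. a [^] m) ` (\<lambda>a. g \<otimes> a \<otimes> inv g) ` A" by (simp only: image_image)
  also have "\<dots> = powers A m" by (simp only: g(2) powers_def)
  finally show "g \<in> normalizer G (powers A m)"
    using g(1) mem_normalizer_iff_image[OF subgroup.subset[OF powers_subgroup]] by blast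
qed

lemma powers_normal:
  assumes "A \<lhd> G"
  shows "powers A m \<lhd> G"
  using assms normalizer_subset_normalizer_powers[of m] normal_iff_normalizer[OF subgroup_axioms]
    normal_iff_normalizer[OF powers_subgroup] normalizer_subset[OF
      subgroup.subset[OF powers_subgroup]]
  by blast

lemma finitely_generated_hom_img:
  assumes "group_hom (G\<lparr>carrier := A\<rparr>) G f" and "finitely_generated A"
  shows "finitely_generated (f ` A)"
proof -
  interpret f: group_hom "G\<lparr>carrier := A\<rparr>" G f by fact
  obtain S where S: "finite S" "S \<subseteq> A" "generate G S = A"
    using assms(2) by (auto simp: finitely_generated_over_def)
  have "generate (G\<lparr>carrier := A\<rparr>) S = A"
    using generate_consistent[OF S(2) subgroup_axioms] S(3) by simp
  hence "generate G (f ` S \<union> {}) = f ` A" using f.generate_img[of S] S(2) by simp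
  thus ?thesis unfolding finitely_generated_over_def using S(1,2) by (intro exI[of _ "f ` S"]) auto
qed

lemma finite_mod_powers:
  assumes "finitely_generated A" "m > 0"
  shows "finite_mod A (powers A m)"
proof (rule finite_mod_if_torsion_mod[OF subgroup_axioms powers_subgroup powers_subset])
  show "finitely_generated_over (powers A m) A"
    by (rule finitely_generated_over_if_finitely_generated[OF subgroup_axioms assms(1)
      powers_subset])
  show "commutator G a b \<in> powers A m" if "a \<in> A" "b \<in> A" for a b
  proof -
    have "commutator G a b = \<one>" using that comm by (simp add: commutator_eq_one_iff)
    thus ?thesis using subgroup.one_closed[OF powers_subgroup] by simp
  qed
  show "\<exists>q::nat > 0. a [^] q \<in> powers A m" if "a \<in> A" for a
    using that assms(2) by (auto simp: powers_def)
qed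

lemma generate_insert_decomp:
  assumes "S \<subseteq> A" "b \<in> A" "a \<in> generate G (insert b S)"
  obtains c and i :: int where "c \<in> generate G S" "a = c \<otimes> b [^] i"
proof -
  have S: "S \<subseteq> carrier G" using assms(1) subset by blast
  have "generate G S \<subseteq> A" by (rule generate_subgroup_incl[OF assms(1) subgroup_axioms])
  hence "commutator G c a \<in> generate G S" if "c \<in> generate G S" "a \<in> A" for c a
    using that comm[of c a] generate.one[of G S] commutator_eq_one_iff[of c a]
    by (simp add: subset_iff)
  hence "A \<subseteq> normalizer G (generate G S)"
    by (intro subset_normalizer_if_commutators generate_is_subgroup[OF S] subgroup_axioms)
  hence "generate G (insert b S) = cyclic_extension (generate G S) b"
    using assms(2) by (intro generate_insert_eq_cyclic_extension[OF S]) blast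
  thus ?thesis using assms(3) that unfolding cyclic_extension_def by blast
qed

lemma generate_insert_pow_mem:
  assumes "S \<subseteq> A" "b \<in> A" "b [^] (r::nat) \<in> generate G S" "a \<in> generate G (insert b S)"
  shows "a [^] r \<in> generate G S"
proof -
  interpret C: subgroup "generate G S" G
    using assms(1) subset by (intro generate_is_subgroup) (rule subset_trans)
  have generate_subset: "generate G S \<subseteq> A"
    by (rule generate_subgroup_incl[OF assms(1) subgroup_axioms])
  obtain c and i :: int where c: "c \<in> generate G S" "a = c \<otimes> b [^] i"
    using generate_insert_decomp[OF assms(1,2,4)] .
  have "a [^] r = c [^] r \<otimes> (b [^] i) [^] r"
    using c assms(2) generate_subset subgroup_int_pow_closed[OF subgroup_axioms]
    by (auto intro: nat_pow_distrib)
  also have "(b [^] i) [^] r = (b [^] r) [^] i"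
    using assms(2) by (simp add: int_pow_pow mult.commute flip: int_pow_int)
  also have "c [^] r \<otimes> (b [^] r) [^] i \<in> generate G S"
    using c(1) assms(3) C.subgroup_axioms
    by (simp add: subgroup_nat_pow_closed subgroup_int_pow_closed)
  finally show ?thesis .
qed

lemma generate_insert_torsion_mem:
  assumes "S \<subseteq> A" "b \<in> A" and independent: "\<And>r::nat. b [^] r \<in> generate G S \<Longrightarrow> r = 0"
    and "a \<in> generate G (insert b S)" "ord a \<noteq> 0"
  shows "a \<in> generate G S"
proof -
  interpret C: subgroup "generate G S" G
    using assms(1) subset by (intro generate_is_subgroup) (rule subset_trans)
  have generate_subset: "generate G S \<subseteq> A"
    by (rule generate_subgroup_incl[OF assms(1) subgroup_axioms])
  obtain c and i :: int where c: "c \<in> generate G S" "a = c \<otimes> b [^] i"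
    using generate_insert_decomp[OF assms(1,2,4)] .
  have a: "a \<in> carrier G" using c assms(2) by simp
  have "\<one> = a [^] int (ord a)" using a by (simp add: int_pow_int)
  also have "\<dots> = c [^] int (ord a) \<otimes> (b [^] i) [^] int (ord a)"
    unfolding c(2) using c(1) assms(2) generate_subset subgroup_int_pow_closed[OF subgroup_axioms]
    by (auto intro: int_pow_distrib)
  also have "(b [^] i) [^] int (ord a) = b [^] (i * int (ord a))"
    using assms(2) by (simp add: int_pow_pow)
  finally have "b [^] (i * int (ord a)) = inv (c [^] int (ord a))"
    using c(1) assms(2)
    by (metis C.mem_carrier int_pow_closed inv_equality inv_inv inv_closed mem_carrier)
  hence "b [^] (i * int (ord a)) \<in> generate G S"
    using c(1) subgroup_int_pow_closed[OF C.subgroup_axioms] by simp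
  hence "nat \<bar>i * int (ord a)\<bar> = 0"
    using assms(2) by (intro independent int_pow_mem_imp_abs_pow_mem C.subgroup_axioms) auto
  hence "i = 0" using assms(5) by simp
  thus ?thesis using c by simp
qed

lemma torsion_bounded:
  assumes "finitely_generated A"
  shows "\<exists>t::nat > 0. \<forall>a \<in> A. ord a \<noteq> 0 \<longrightarrow> a [^] t = \<one>"
proof -
  have "\<exists>t::nat > 0. \<forall>a \<in> generate G S. ord a \<noteq> 0 \<longrightarrow> a [^] t = \<one>" if "finite S" "S \<subseteq> A" for S
    using that
  proof (induction S rule: finite_induct)
    case empty
    show ?case by (intro exI[of _ 1]) (simp add: generate_empty)
  next
    case (insert b S)
    hence b: "b \<in> A" and S: "S \<subseteq> A" by auto
    obtain t :: nat where t: "t > 0"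
      "\<And>a. \<lbrakk>a \<in> generate G S; ord a \<noteq> 0\<rbrakk> \<Longrightarrow> a [^] t = \<one>"
      using insert.IH[OF S] by blast
    show ?case
    proof (cases "\<exists>r::nat > 0. b [^] r \<in> generate G S")
      case True
      then obtain r :: nat where r: "r > 0" "b [^] r \<in> generate G S" by blast
      have "a [^] (r * t) = \<one>" if a: "a \<in> generate G (insert b S)" "ord a \<noteq> 0" for a
      proof -
        have carrier: "a \<in> carrier G" using a(1) b S subset by (intro generate_in_carrier) auto
        have "(a [^] r) [^] ord a = \<one>" using carrier by (simp add: nat_pow_pow pow_eq_id)
        hence "ord (a [^] r) \<noteq> 0" using carrier a(2) by (auto simp: pow_eq_id)
        hence "(a [^] r) [^] t = \<one>" using t(2) generate_insert_pow_mem[OF S b r(2) a(1)] by blast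
        thus ?thesis using carrier by (simp add: nat_pow_pow)
      qed
      thus ?thesis using r(1) t(1) by (intro exI[of _ "r * t"]) simp
    next
      case False
      hence independent: "r = 0" if "b [^] r \<in> generate G S" for r :: nat using that by auto
      have "a [^] t = \<one>" if "a \<in> generate G (insert b S)" "ord a \<noteq> 0" for a
        using generate_insert_torsion_mem[OF S b independent that] that(2) by (rule t(2))
      thus ?thesis using t(1) by (intro exI[of _ t]) simp
    qed
  qed
  thus ?thesis using assms by (auto simp: finitely_generated_over_def)
qed

lemma torsion_free_powers:
  assumes "finitely_generated A"
  shows "\<exists>t > 0. torsion_free (powers A t)"
proof -
  obtain t :: nat where t: "t > 0" "\<And>a. \<lbrakk>a \<in> A; ord a \<noteq> 0\<rbrakk> \<Longrightarrow> a [^] t = \<one>"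
    using torsion_bounded[OF assms] by blast
  have "a [^] t = \<one>" if a: "a \<in> A" "ord (a [^] t) \<noteq> 0" for a
  proof (rule t(2)[OF a(1)])
    show "ord a \<noteq> 0"
    proof
      assume "ord a = 0"
      thus False using a t(1) by (simp add: ord_pow_gen)
    qed
  qed
  thus ?thesis using t(1) by (auto simp: torsion_free_def powers_def)
qed

lemma divisible_generate_insert:
  assumes S: "S \<subseteq> A" and a: "a \<in> A" and div: "divisible (generate G (insert a S))"
  shows "a \<in> generate G S"
proof -
  interpret C: subgroup "generate G S" G
    using S subset by (intro generate_is_subgroup) (rule subset_trans)
  have generate_subset: "generate G S \<subseteq> A" by (rule generate_subgroup_incl[OF S subgroup_axioms])
  have root: "\<exists>e \<in> generate G (insert a S). e [^] m = a" if "m > 0" for m :: nat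
    using div that generate.incl[of a "insert a S" G] by (auto simp: divisible_def)
  obtain e where e: "e \<in> generate G (insert a S)" "e [^] (2::nat) = a" using root[of 2] by auto
  obtain c and i :: int where c: "c \<in> generate G S" "e = c \<otimes> a [^] i"
    using generate_insert_decomp[OF S a e(1)] .
  have "a = e [^] (2::int)" using e(2) by (simp flip: int_pow_int)
  also have "\<dots> = c [^] (2::int) \<otimes> (a [^] i) [^] (2::int)"
    unfolding c(2) using c(1) a generate_subset subgroup_int_pow_closed[OF subgroup_axioms]
    by (auto intro: int_pow_distrib)
  also have "\<dots> = c [^] (2::int) \<otimes> a [^] (i * 2)" using a by (simp add: int_pow_pow)
  finally have "a \<otimes> inv (a [^] (i * 2)) = c [^] (2::int)"
    using a c(1) by (metis C.mem_carrier int_pow_closed inv_solve_right mem_carrier)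
  moreover have "a [^] (1 - i * 2) = a \<otimes> inv (a [^] (i * 2))"
    using int_pow_diff[of a 1 "i * 2"] a by simp
  ultimately have "a [^] (1 - i * 2) \<in> generate G S"
    using c(1) subgroup_int_pow_closed[OF C.subgroup_axioms] by simp
  hence r: "a [^] nat \<bar>1 - i * 2\<bar> \<in> generate G S"
    using a by (intro int_pow_mem_imp_abs_pow_mem C.subgroup_axioms) auto
  have "1 - i * 2 \<noteq> 0" by presburger
  then obtain f where "f \<in> generate G (insert a S)" "f [^] nat \<bar>1 - i * 2\<bar> = a"
    using root[of "nat \<bar>1 - i * 2\<bar>"] by auto
  thus ?thesis using generate_insert_pow_mem[OF S a r] by metis
qed

lemma finitely_generated_divisible_trivial:
  assumes "finitely_generated A" "divisible A"
  shows "A = {\<one>}"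
proof -
  have "generate G S = {\<one>}" if "finite S" "S \<subseteq> A" "divisible (generate G S)" for S
    using that
  proof (induction S rule: finite_induct)
    case empty
    show ?case by (rule generate_empty)
  next
    case (insert a S)
    hence a: "a \<in> A" and S: "S \<subseteq> A" by auto
    have "insert a S \<subseteq> generate G S"
      using divisible_generate_insert[OF S a insert.prems(2)] generate.incl[of _ S G] by blast
    moreover have "subgroup (generate G S) G"
      using S subset by (intro generate_is_subgroup) (rule subset_trans)
    ultimately have "generate G (insert a S) = generate G S"
      using generate_subgroup_incl[of "insert a S" "generate G S"] mono_generate[of S "insert a S"]
      by blast
    thus ?case using insert.IH[OF S] insert.prems(2) by simp
  qed
  thus ?thesis using assms by (auto simp: finitely_generated_over_def)
qed

end

section \<open>Elements acting with finite order\<close>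

locale finite_order_action = abelian_subgroup +
  fixes x :: 'a and k :: nat
  assumes torsion_free: "torsion_free A"
    and normalizes: "x \<in> normalizer G A"
    and k_pos: "k > 0"
    and pow_centralizes: "x [^] k \<in> centralizer A"
begin

lemma x_closed [simp]: "x \<in> carrier G"
  using normalizes normalizer_subset[OF subset] by blast

abbreviation \<delta> :: "'a \<Rightarrow> 'a" where
  "\<delta> a \<equiv> commutator G a x"

definition D :: "'a set" where
  "D = \<delta> ` A"

lemma conj_closed: "a \<in> A \<Longrightarrow> inv x \<otimes> a \<otimes> x \<in> A" "a \<in> A \<Longrightarrow> x \<otimes> a \<otimes> inv x \<in> A"
  using normalizer_conj_mem[OF subset normalizes] by auto

lemma \<delta>_closed: "a \<in> A \<Longrightarrow> \<delta> a \<in> A"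
  by (rule commutator_mem_normalizer(1)[OF subgroup_axioms _ normalizes])

lemma \<delta>_hom: "group_hom (G\<lparr>carrier := A\<rparr>) G \<delta>"
proof (unfold_locales, rule homI)
  fix a b assume "a \<in> carrier (G\<lparr>carrier := A\<rparr>)" "b \<in> carrier (G\<lparr>carrier := A\<rparr>)"
  hence ab: "a \<in> A" "b \<in> A" by auto
  have "\<delta> (a \<otimes> b) = inv b \<otimes> \<delta> a \<otimes> inv x \<otimes> b \<otimes> x"
    using ab by (simp add: word_simps)
  also have "\<dots> = \<delta> a \<otimes> inv b \<otimes> inv x \<otimes> b \<otimes> x"
    using comm[OF \<delta>_closed[OF ab(1)], of "inv b"] ab by simp
  also have "\<dots> = \<delta> a \<otimes> \<delta> b" using ab by (simp add: word_simps)
  finally show "\<delta> (a \<otimes>\<^bsub>G\<lparr>carrier := A\<rparr>\<^esub> b) = \<delta> a \<otimes> \<delta> b" by simp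
qed simp

lemma \<delta>_nat_pow: "a \<in> A \<Longrightarrow> \<delta> (a [^] (n::nat)) = \<delta> a [^] n"
  using group_hom.hom_nat_pow[OF \<delta>_hom, of a n] by (simp flip: nat_pow_consistent)

lemma D_subset: "D \<subseteq> A"
  using \<delta>_closed by (auto simp: D_def)

lemma D_subgroup: "subgroup D G"
  using group_hom.img_is_subgroup[OF \<delta>_hom] by (simp add: D_def)

sublocale D: abelian_subgroup G D
  by (rule abelian_subgroup_subset[OF D_subgroup D_subset])

lemma \<delta>_mem_D: "a \<in> A \<Longrightarrow> \<delta> a \<in> D"
  by (simp add: D_def)

lemma normalizes_D: "x \<in> normalizer G D"
proof -
  have "inv x \<otimes> \<delta> a \<otimes> x = \<delta> (inv x \<otimes> a \<otimes> x)" "x \<otimes> \<delta> a \<otimes> inv x = \<delta> (x \<otimes> a \<otimes> inv x)"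
    if "a \<in> A" for a
    using that by (simp_all add: word_simps)
  thus ?thesis unfolding mem_normalizer_iff[OF D.subset] using conj_closed by (auto simp: D_def)
qed

lemma normalizes_powers_D: "x \<in> normalizer G (powers D m)"
  using normalizes_D D.normalizer_subset_normalizer_powers by blast

lemma conj_nat_pow_decomp:
  assumes E: "subgroup E G" "E \<subseteq> A" "x \<in> normalizer G E" and a: "a \<in> A" and d: "\<delta> (\<delta> a) \<in> E"
  shows "\<exists>e \<in> E. inv (x [^] (j::nat)) \<otimes> a \<otimes> x [^] j = a \<otimes> \<delta> a [^] j \<otimes> e"
proof (induction j)
  case 0
  show ?case using a subgroup.one_closed[OF E(1)] by (intro bexI[of _ \<one>]) simp_all
next
  case (Suc j)
  interpret E: subgroup E G by (rule E(1))
  interpret conj: group_hom G G "\<lambda>y. inv x \<otimes> y \<otimes> x" using conj_hom[of "inv x"] by simp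
  obtain e where e: "e \<in> E" "inv (x [^] j) \<otimes> a \<otimes> x [^] j = a \<otimes> \<delta> a [^] j \<otimes> e"
    using Suc by blast
  have pow: "\<delta> a [^] j \<in> A" by (rule subgroup_nat_pow_closed[OF subgroup_axioms \<delta>_closed[OF a]])
  have conj_eq: "inv x \<otimes> b \<otimes> x = b \<otimes> \<delta> b" if "b \<in> A" for b using that by (simp add: word_simps)
  let ?e = "\<delta> (\<delta> a) [^] j \<otimes> (inv x \<otimes> e \<otimes> x)"
  have e': "inv x \<otimes> e \<otimes> x \<in> E" by (rule normalizer_conj_mem(2)[OF E.subset E(3) e(1)])
  have "inv (x [^] Suc j) \<otimes> a \<otimes> x [^] Suc j = inv x \<otimes> (inv (x [^] j) \<otimes> a \<otimes> x [^] j) \<otimes> x"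
    using a by (simp add: word_simps)
  also have "\<dots> = (inv x \<otimes> a \<otimes> x) \<otimes> (inv x \<otimes> \<delta> a [^] j \<otimes> x) \<otimes> (inv x \<otimes> e \<otimes> x)"
    unfolding e(2) using a e(1) by (simp only: conj.hom_mult mem_carrier E.mem_carrier pow m_closed)
  also have "\<dots> = (a \<otimes> \<delta> a) \<otimes> (\<delta> a [^] j \<otimes> \<delta> (\<delta> a) [^] j) \<otimes> (inv x \<otimes> e \<otimes> x)"
    by (simp only: conj_eq[OF a] conj_eq[OF pow] \<delta>_nat_pow[OF \<delta>_closed[OF a]])
  also have "\<dots> = a \<otimes> (\<delta> a \<otimes> \<delta> a [^] j) \<otimes> ?e" using a d e' by (simp add: m_assoc del: nat_pow_Suc)
  also have "\<delta> a \<otimes> \<delta> a [^] j = \<delta> a [^] Suc j"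
    using a by (simp only: nat_pow_Suc2 commutator_closed mem_carrier x_closed)
  finally show ?case using subgroup_nat_pow_closed[OF E(1) d] e' by (intro bexI[of _ ?e]) simp_all
qed

text \<open>For \<open>d = \<delta> a\<close> and \<open>j = k\<close> the decomposition above reads \<open>a = a d\<^sup>k e\<close>.\<close>
lemma D_pow_mem:
  assumes E: "subgroup E G" "E \<subseteq> A" "x \<in> normalizer G E" and d: "d \<in> D" "\<delta> d \<in> E"
  shows "d [^] k \<in> E"
proof -
  obtain a where a: "a \<in> A" "d = \<delta> a" using d(1) by (auto simp: D_def)
  obtain e where e: "e \<in> E" "inv (x [^] k) \<otimes> a \<otimes> x [^] k = a \<otimes> d [^] k \<otimes> e"
    using conj_nat_pow_decomp[OF E a(1), folded a(2), OF d(2), of k] by (rule bexE)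
  have e_carrier: "e \<in> carrier G" by (rule subgroup.mem_carrier[OF E(1) e(1)])
  have "a \<otimes> x [^] k = x [^] k \<otimes> a"
    using pow_centralizes a(1) by (simp add: mem_centralizer_iff[OF subset])
  hence "inv (x [^] k) \<otimes> a \<otimes> x [^] k = a" using a(1) by (simp add: m_assoc)
  hence "a \<otimes> (d [^] k \<otimes> e) = a" using e(2) a(1) d(1) e_carrier by (simp add: m_assoc)
  hence "d [^] k \<otimes> e = \<one>" using a(1) d(1) e_carrier by simp
  hence "d [^] k = inv e" using d(1) e_carrier by (simp add: inv_equality)
  thus ?thesis using subgroup.m_inv_closed[OF E(1) e(1)] by simp
qed

lemma D_fixed_trivial:
  assumes "d \<in> D" "d \<otimes> x = x \<otimes> d"
  shows "d = \<one>"
proof -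
  have "\<delta> d = \<one>" using assms by (simp add: commutator_eq_one_iff)
  hence "d [^] k \<in> {\<one>}"
    by (intro D_pow_mem) (use assms in \<open>auto simp: triv_subgroup normalizer_singleton_one\<close>)
  thus ?thesis using torsion_freeD[OF torsion_free subset, of d k] assms(1) D_subset k_pos by blast
qed

lemma D_pow_inj:
  assumes "d \<in> D" "e \<in> D" "d [^] m = e [^] m" "(m::nat) > 0"
  shows "d = e"
proof -
  have "(d \<otimes> inv e) [^] m = e [^] m \<otimes> (inv e) [^] m"
    using assms by (simp add: D.nat_pow_distrib)
  also have "\<dots> = \<one>" using assms by (simp add: nat_pow_inv)
  finally have "d \<otimes> inv e = \<one>"
    using torsion_freeD[OF torsion_free subset, of "d \<otimes> inv e" m] assms D_subset D.m_closed
      D.m_inv_closed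
    by blast
  thus ?thesis using assms by (metis D.mem_carrier inv_closed inv_equality inv_inv)
qed

definition power_extension :: "nat \<Rightarrow> 'a set" where
  "power_extension m = cyclic_extension (powers D m) x"

lemma power_extension_subgroup: "subgroup (power_extension m) G"
  unfolding power_extension_def
  by (rule cyclic_extension_subgroup[OF D.powers_subgroup normalizes_powers_D])

lemma x_mem_power_extension: "x \<in> power_extension m"
  unfolding power_extension_def by (rule mem_cyclic_extension[OF D.powers_subgroup x_closed])

lemma power_extension_inter_D: "power_extension m \<inter> D = powers D m"
  unfolding power_extension_def
proof (rule cyclic_extension_inter[OF D.powers_subgroup D.powers_subset D_subgroup x_closed])
  fix i :: int assume "x [^] i \<in> D"
  moreover have "x [^] i \<otimes> x = x \<otimes> x [^] i"
    by (metis add.commute int_pow_1 int_pow_mult x_closed)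
  ultimately show "x [^] i = \<one>" by (rule D_fixed_trivial)
qed

lemma power_extension_not_nilpotent:
  assumes "D \<noteq> {\<one>}" "m > 0"
  shows "\<not> nilpotent_group (G\<lparr>carrier := power_extension m\<rparr>)"
proof -
  have "\<exists>e \<in> lcs_in G (power_extension m) c. e \<in> D \<and> e \<noteq> \<one>" for c
  proof (induction c)
    case 0
    obtain d where d: "d \<in> D" "d \<noteq> \<one>" using assms(1) D.one_closed by blast
    have "d [^] m \<noteq> \<one>"
      using torsion_freeD[OF torsion_free subset, of d m] d D_subset assms(2) by blast
    moreover have "d [^] m \<in> power_extension m \<inter> D"
      using d(1) by (simp add: power_extension_inter_D powers_def)
    ultimately show ?case by auto
  next
    case (Suc c)
    then obtain e where e: "e \<in> lcs_in G (power_extension m) c" "e \<in> D" "e \<noteq> \<one>" by blast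
    have "\<delta> e \<in> lcs_in G (power_extension m) (Suc c)"
      using e(1) x_mem_power_extension by (simp add: commutator_mem_commutator_subgroup)
    moreover have "\<delta> e \<in> D" using e(2) D_subset \<delta>_mem_D by blast
    moreover have "\<delta> e \<noteq> \<one>"
      using D_fixed_trivial[OF e(2)] e(2,3) by (auto simp: commutator_eq_one_iff)
    ultimately show ?case by blast
  qed
  thus ?thesis unfolding nilpotent_subgroup_iff[OF power_extension_subgroup] by blast
qed

lemma D_pow_mem_if_power_extension_normal:
  assumes "power_extension m \<lhd> G" "d \<in> D"
  shows "d [^] k \<in> powers D m"
proof (rule D_pow_mem[OF D.powers_subgroup _ normalizes_powers_D assms(2)])
  interpret normal "power_extension m" G by fact
  show "powers D m \<subseteq> A" using D.powers_subset D_subset by blast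
  have "normalizer G (power_extension m) = carrier G"
    using assms(1) normal_iff_normalizer[OF power_extension_subgroup] by blast
  hence "\<delta> d \<in> power_extension m"
    using assms(2)
    by (intro commutator_mem_normalizer(2)[OF power_extension_subgroup x_mem_power_extension]) simp
  thus "\<delta> d \<in> powers D m" using assms(2) D_subset \<delta>_mem_D power_extension_inter_D by blast
qed

lemma root_if_pow_mem_powers:
  assumes "d \<in> D" "n > 0" "d [^] n \<in> powers D (n * m)"
  shows "\<exists>e \<in> D. e [^] (m::nat) = d"
proof -
  obtain e where e: "e \<in> D" "d [^] n = e [^] (n * m)" using assms(3) by (auto simp: powers_def)
  have "d [^] n = (e [^] m) [^] n" using e by (simp add: nat_pow_pow mult.commute)
  hence "d = e [^] m"
    by (rule D_pow_inj[OF assms(1) subgroup_nat_pow_closed[OF D_subgroup e(1)] _ assms(2)])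
  thus ?thesis using e(1) by blast
qed

lemma power_extension_psubset_if_no_root:
  assumes d: "d \<in> D" "\<not> (\<exists>e \<in> D. e [^] (m::nat) = d)" and "n > 0"
  shows "power_extension (n * m) \<subset> power_extension n"
proof
  show "power_extension (n * m) \<subseteq> power_extension n"
    unfolding power_extension_def by (intro cyclic_extension_mono D.powers_mult_subset)
  show "power_extension (n * m) \<noteq> power_extension n"
  proof
    assume "power_extension (n * m) = power_extension n"
    hence "powers D (n * m) = powers D n" by (simp flip: power_extension_inter_D)
    hence "d [^] n \<in> powers D (n * m)" using d(1) by (simp add: powers_def)
    thus False using root_if_pow_mem_powers[OF d(1) assms(3)] d(2) by blast
  qed
qed

lemma D_divisible:
  assumes overgroups: non_nilpotent_overgroups_normal
  shows "divisible D"
  unfolding divisible_def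
proof (intro ballI allI impI, rule ccontr)
  fix d and m :: nat
  assume d: "d \<in> D" and m: "m > 0" and no_root: "\<not> (\<exists>e \<in> D. e [^] m = d)"
  have "d \<noteq> \<one>" using no_root D.one_closed nat_pow_one[of m] by blast
  hence "D \<noteq> {\<one>}" using d by blast
  hence "\<not> nilpotent_group (G\<lparr>carrier := power_extension (k * m * m)\<rparr>)"
    using k_pos m by (intro power_extension_not_nilpotent) simp_all
  moreover have "power_extension (k * m * m) \<subset> power_extension (k * m)"
    using k_pos m by (intro power_extension_psubset_if_no_root[OF d no_root]) simp
  ultimately have "power_extension (k * m) \<lhd> G"
    by (intro non_nilpotent_overgroups_normalD[OF overgroups power_extension_subgroup
      power_extension_subgroup])
  hence "d [^] k \<in> powers D (k * m)" using d by (rule D_pow_mem_if_power_extension_normal)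
  thus False using root_if_pow_mem_powers[OF d k_pos] no_root by blast
qed

lemma centralizes:
  assumes overgroups: non_nilpotent_overgroups_normal and fg: "finitely_generated A"
  shows "x \<in> centralizer A"
proof -
  have "finitely_generated D" unfolding D_def by (rule finitely_generated_hom_img[OF \<delta>_hom fg])
  hence "D = {\<one>}" using D_divisible[OF overgroups] by (rule D.finitely_generated_divisible_trivial)
  hence "\<delta> a = \<one>" if "a \<in> A" for a using \<delta>_mem_D[OF that] by simp
  thus ?thesis by (simp add: mem_centralizer_iff[OF subset] commutator_eq_one_iff)
qed

end

section \<open>Transfer into a central subgroup\<close>

locale central_transfer = group +
  fixes A L :: "'a set"
  assumes A_subgroup: "subgroup A G"
    and A_central: "A \<subseteq> centralizer (carrier G)"
    and L_subgroup: "subgroup L G"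
    and L_finite_mod_A: "finite_mod L A"
begin

sublocale L: subgroup L G by (rule L_subgroup)

lemma central: "\<lbrakk>a \<in> A; g \<in> carrier G\<rbrakk> \<Longrightarrow> g \<otimes> a = a \<otimes> g"
  using A_central by (auto simp: mem_centralizer_iff)

sublocale A: abelian_subgroup G A
proof -
  interpret subgroup A G by (rule A_subgroup)
  show "abelian_subgroup G A" by unfold_locales (use central in auto)
qed

definition cosets :: "'a set set" where
  "cosets = (#>) A ` L"

lemma finite_cosets: "finite cosets"
  unfolding cosets_def by (rule finite_r_cosets_if_finite_mod[OF L_finite_mod_A A_subgroup])

lemma cosets_mult_closed: "\<lbrakk>c \<in> cosets; l \<in> L\<rbrakk> \<Longrightarrow> c #> l \<in> cosets"
  by (auto simp: cosets_def coset_mult_assoc[OF A.subset])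

lemma cosets_mult_mult:
  "\<lbrakk>c \<in> cosets; l \<in> L; l' \<in> L\<rbrakk> \<Longrightarrow> c #> l #> l' = c #> (l \<otimes> l')"
  by (auto simp: cosets_def coset_mult_assoc[OF A.subset] m_assoc)

lemma inj_on_cosets_mult: "l \<in> L \<Longrightarrow> inj_on (\<lambda>c. c #> l) cosets"
proof (rule inj_on_inverseI[where g = "\<lambda>c. c #> inv l"])
  fix c assume "l \<in> L" "c \<in> cosets"
  thus "c #> l #> inv l = c"
    by (auto simp: cosets_mult_mult) (auto simp: cosets_def A.subset coset_mult_assoc)
qed

lemma cosets_mult_image: "l \<in> L \<Longrightarrow> (\<lambda>c. c #> l) ` cosets = cosets"
  using endo_inj_surj[OF finite_cosets _ inj_on_cosets_mult] cosets_mult_closed by blast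

definition rep :: "'a set \<Rightarrow> 'a" where
  "rep c = (SOME l. l \<in> L \<and> A #> l = c)"

lemma rep:
  assumes "c \<in> cosets"
  shows "rep c \<in> L" "A #> rep c = c"
  using assms someI_ex[of "\<lambda>l. l \<in> L \<and> A #> l = c"] by (auto simp: rep_def cosets_def)

definition factor :: "'a \<Rightarrow> 'a set \<Rightarrow> 'a" where
  "factor l c = rep c \<otimes> l \<otimes> inv (rep (c #> l))"

lemma factor_mem:
  assumes "l \<in> L" "c \<in> cosets"
  shows "factor l c \<in> A"
proof -
  note reps = rep[OF assms(2)] rep[OF cosets_mult_closed[OF assms(2,1)]]
  have "A #> (rep c \<otimes> l) = A #> rep (c #> l)"
    using reps assms(1) by (simp add: A.subset flip: coset_mult_assoc)
  thus ?thesis using reps(1,3) assms(1) by (simp add: factor_def r_coset_eq_iff[OF A_subgroup])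
qed

definition transfer :: "'a \<Rightarrow> 'a" where
  "transfer l = finprod (G\<lparr>carrier := A\<rparr>) (factor l) cosets"

lemma transfer_closed: "l \<in> L \<Longrightarrow> transfer l \<in> A"
  unfolding transfer_def using A.subgroup_group.finprod_closed[of "factor l" cosets] factor_mem
  by auto

lemma transfer_mult:
  assumes l: "l \<in> L" "l' \<in> L"
  shows "transfer (l \<otimes> l') = transfer l \<otimes> transfer l'"
proof -
  let ?A = "G\<lparr>carrier := A\<rparr>"
  have "transfer (l \<otimes> l') = finprod ?A (\<lambda>c. factor l c \<otimes>\<^bsub>?A\<^esub> factor l' (c #> l)) cosets"
    unfolding transfer_def
  proof (rule A.subgroup_group.finprod_cong')
    fix c assume c: "c \<in> cosets"
    note reps = rep[OF c] rep[OF cosets_mult_closed[OF c l(1)]]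
      rep[OF cosets_mult_closed[OF cosets_mult_closed[OF c l(1)] l(2)]]
    show "factor (l \<otimes> l') c = factor l c \<otimes>\<^bsub>?A\<^esub> factor l' (c #> l)"
      using reps l by (simp add: factor_def m_assoc flip: cosets_mult_mult[OF c l])
  qed (use factor_mem cosets_mult_closed l in auto)
  also have "\<dots> = transfer l \<otimes>\<^bsub>?A\<^esub> finprod ?A (\<lambda>c. factor l' (c #> l)) cosets"
    unfolding transfer_def
    by (intro A.subgroup_group.finprod_multf) (use factor_mem cosets_mult_closed l in auto)
  also have "finprod ?A (\<lambda>c. factor l' (c #> l)) cosets = transfer l'"
    unfolding transfer_def
    using A.subgroup_group.finprod_reindex[OF _ inj_on_cosets_mult[OF l(1)], of "factor l'"]
      factor_mem[OF l(2)]
    by (simp add: cosets_mult_image[OF l(1)])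
  finally show ?thesis by simp
qed

lemma transfer_hom: "group_hom (G\<lparr>carrier := L\<rparr>) G transfer"
  using L.subgroup_is_group[OF is_group] transfer_closed
  by (intro group_hom.intro group_hom_axioms.intro is_group homI) (auto simp: transfer_mult)

lemma transfer_nat_pow: "l \<in> L \<Longrightarrow> transfer (l [^] (n::nat)) = transfer l [^] n"
  using group_hom.hom_nat_pow[OF transfer_hom, of l n] by (simp flip: nat_pow_consistent)

lemma transfer_central:
  assumes "a \<in> A" "a \<in> L"
  shows "transfer a = a [^] card cosets"
proof -
  have "transfer a = finprod (G\<lparr>carrier := A\<rparr>) (\<lambda>c. a) cosets"
    unfolding transfer_def
  proof (rule A.subgroup_group.finprod_cong')
    fix c assume c: "c \<in> cosets"
    note reps = rep[OF c]
    have "A #> (rep c \<otimes> a) = A #> rep c"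
      using assms reps(1) central[of a "rep c"]
      by (subst r_coset_eq_iff[OF A_subgroup]) (auto simp: m_assoc)
    hence "c #> a = c" using reps assms(2) by (metis A.subset L.mem_carrier coset_mult_assoc)
    thus "factor a c = a"
      using assms reps(1) central[of a "rep c"] by (simp add: factor_def m_assoc)
  qed (use assms in auto)
  also have "\<dots> = a [^]\<^bsub>G\<lparr>carrier := A\<rparr>\<^esub> card cosets"
    using assms(1) by (intro A.subgroup_group.finprod_const) simp
  also have "\<dots> = a [^] card cosets" by (simp flip: nat_pow_consistent)
  finally show ?thesis .
qed

lemma transfer_kernel_inter:
  assumes "torsion_free A"
  shows "kernel (G\<lparr>carrier := L\<rparr>) G transfer \<inter> A \<subseteq> {\<one>}"
proof
  fix a assume "a \<in> kernel (G\<lparr>carrier := L\<rparr>) G transfer \<inter> A"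
  hence a: "a \<in> A" "a [^] card cosets = \<one>" using transfer_central[of a] by (auto simp: kernel_def)
  have "cosets \<noteq> {}" using L.one_closed unfolding cosets_def by blast
  hence "card cosets > 0" using finite_cosets by (simp add: card_gt_0_iff)
  thus "a \<in> {\<one>}" using torsion_freeD[OF assms A.subset a] by simp
qed

text \<open>Some power of \<open>l\<close> lies in \<open>A\<close> and so is fixed by conjugation, and roots in \<open>A\<close> are unique.\<close>
lemma transfer_conj:
  assumes tf: "torsion_free A" and l: "l \<in> L" and g: "g \<in> carrier G" "g \<otimes> l \<otimes> inv g \<in> L"
  shows "transfer (g \<otimes> l \<otimes> inv g) = transfer l"
proof -
  interpret conj: group_hom G G "\<lambda>y. g \<otimes> y \<otimes> inv g" by (rule conj_hom[OF g(1)])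
  let ?u = "transfer (g \<otimes> l \<otimes> inv g)" and ?v = "transfer l"
  have uv: "?u \<in> A" "?v \<in> A" using transfer_closed l g(2) by auto
  obtain q :: nat where q: "q > 0" "l [^] q \<in> A"
    using finite_mod_pow_mem[OF L_finite_mod_A A_subgroup L_subgroup l] .
  have "(g \<otimes> l \<otimes> inv g) [^] q = g \<otimes> l [^] q \<otimes> inv g" using conj.hom_nat_pow[of l q] l by simp
  also have "\<dots> = l [^] q" using central[OF q(2) g(1)] l g(1) by (simp add: m_assoc)
  finally have "?u [^] q = ?v [^] q" using transfer_nat_pow l g(2) by metis
  hence "(?u \<otimes> inv ?v) [^] q = \<one>" using uv by (simp add: A.nat_pow_distrib nat_pow_inv)
  hence "?u \<otimes> inv ?v = \<one>" using torsion_freeD[OF tf A.subset] q(1) uv by blast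
  thus ?thesis using uv by (metis A.mem_carrier inv_closed inv_equality inv_inv)
qed

end

lemma (in group) finite_commutator_subgroup:
  assumes A: "subgroup A G" "A \<subseteq> centralizer (carrier G)" "torsion_free A"
    and L: "L \<lhd> G" "finite_mod L A"
  shows "finite (commutator_subgroup G L (carrier G))"
proof -
  interpret L: normal L G by fact
  interpret central_transfer G A L
    by (intro central_transfer.intro central_transfer_axioms.intro is_group A L L.subgroup_axioms)
  interpret transfer: group_hom "G\<lparr>carrier := L\<rparr>" G transfer by (rule transfer_hom)
  let ?K = "kernel (G\<lparr>carrier := L\<rparr>) G transfer"
  have K: "subgroup ?K G" by (rule incl_subgroup[OF L_subgroup transfer.subgroup_kernel])
  have "commutator G l g \<in> ?K" if l: "l \<in> L" and g: "g \<in> carrier G" for l g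
  proof -
    have conj: "inv g \<otimes> l \<otimes> g \<in> L" by (rule L.inv_op_closed1[OF g l])
    have "commutator G l g = inv l \<otimes> (inv g \<otimes> l \<otimes> g)" using l g by (simp add: word_simps)
    moreover have "transfer (inv g \<otimes> l \<otimes> g) = transfer l"
      using transfer_conj[OF A(3) l, of "inv g"] g conj by simp
    moreover have "transfer (inv l) \<otimes> transfer l = \<one>"
      using transfer_mult[of "inv l" l] transfer.hom_one l by simp
    ultimately show ?thesis using l conj by (simp add: kernel_def transfer_mult)
  qed
  hence "commutator_subgroup G L (carrier G) \<subseteq> ?K" by (rule commutator_subgroup_subset[OF K])
  moreover have "finite ?K"
    by (rule finite_if_finite_mod_inter_trivial[OF L(2) A(1) K _ transfer_kernel_inter[OF A(3)]])
      (auto simp: kernel_def)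
  ultimately show ?thesis by (rule finite_subset)
qed

section \<open>Finiteness of a term of the lower central series\<close>

lemma (in group) finite_lcs_if_finite_mod_abelian:
  assumes overgroups: non_nilpotent_overgroups_normal
    and A: "A \<lhd> G" "\<And>a b. \<lbrakk>a \<in> A; b \<in> A\<rbrakk> \<Longrightarrow> a \<otimes> b = b \<otimes> a" "finitely_generated A"
    and centralizing_pow: "\<And>x. x \<in> carrier G \<Longrightarrow> \<exists>k::nat > 0. x [^] k \<in> centralizer A"
    and fin: "finite_mod (lcs G n) A"
  shows "finite (lcs G (Suc n))"
proof -
  interpret normal A G by fact
  interpret A: abelian_subgroup G A by unfold_locales (rule A(2))
  obtain t where t: "t > 0" "torsion_free (powers A t)"
    using A.torsion_free_powers[OF A(3)] by blast
  let ?B = "powers A t"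
  have BA: "?B \<subseteq> A" by (rule A.powers_subset)
  interpret B: abelian_subgroup G ?B by (rule A.abelian_subgroup_subset[OF A.powers_subgroup BA])
  have "finitely_generated ?B"
    unfolding powers_def by (rule A.finitely_generated_hom_img[OF A.nat_pow_hom A(3)])
  have "carrier G \<subseteq> centralizer ?B"
  proof
    fix x assume x: "x \<in> carrier G"
    obtain k :: nat where k: "k > 0" "x [^] k \<in> centralizer A" using centralizing_pow[OF x] by blast
    interpret finite_order_action G ?B x k
    proof
      show "x \<in> normalizer G ?B"
        using A.powers_normal[OF A(1)] normal_iff_normalizer[OF A.powers_subgroup] x by blast
      show "x [^] k \<in> centralizer ?B" using k(2) BA by (auto simp: centralizer_mod_def)
    qed fact+
    show "x \<in> centralizer ?B" by (rule centralizes[OF overgroups]) fact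
  qed
  hence "?B \<subseteq> centralizer (carrier G)"
    using B.subset by (auto simp: mem_centralizer_iff[OF B.subset] mem_centralizer_iff subset_iff)
  moreover have "finite_mod (lcs G n) ?B"
    by (rule finite_mod_trans[OF fin A.finite_mod_powers[OF A(3) t(1)] B.subset])
  ultimately have "finite (commutator_subgroup G (lcs G n) (carrier G))"
    by (rule finite_commutator_subgroup[OF A.powers_subgroup _ t(2) lcs_normal])
  thus ?thesis by (simp add: commutator_subgroup_def)
qed

lemma (in group_hom) finite_mod_lcs_Suc_kernel:
  assumes surj: "h ` carrier G = carrier H" and overgroups: "G.non_nilpotent_overgroups_normal"
    and A: "A \<lhd> G" "\<And>a b. \<lbrakk>a \<in> A; b \<in> A\<rbrakk> \<Longrightarrow> commutator G a b \<in> kernel G H h"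
      "G.finitely_generated_over (kernel G H h) A"
    and centralizing_pow:
      "\<And>x. x \<in> carrier G \<Longrightarrow> \<exists>k::nat > 0. \<forall>a \<in> A. commutator G a (x [^] k) \<in> kernel G H h"
    and fin: "G.finite_mod (lcs G n) A"
  shows "G.finite_mod (lcs G (Suc n)) (kernel G H h)"
proof (rule finite_mod_kernel)
  interpret A: normal A G by fact
  have lcs_img: "lcs H m = h ` lcs G m" for m
    using lcs_in_img[OF G.subgroup_self, of m] by (simp add: lcs_in_carrier surj)
  show "lcs G (Suc n) \<subseteq> carrier G"
    using G.lcs_normal normal_imp_subgroup subgroup.subset by blast
  have "finite (lcs H (Suc n))"
  proof (rule H.finite_lcs_if_finite_mod_abelian[OF
    non_nilpotent_overgroups_normal_img[OF surj overgroups]])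
    show "h ` A \<lhd> H" by (rule A.surj_hom_normal_subgroup[OF group_hom_axioms surj])
    show "u \<otimes>\<^bsub>H\<^esub> v = v \<otimes>\<^bsub>H\<^esub> u" if "u \<in> h ` A" "v \<in> h ` A" for u v
      using that A(2) commute_img_if_commutator_mem_kernel by auto
    obtain S where S: "finite S" "S \<subseteq> A" "generate G (S \<union> kernel G H h) = A"
      using A(3) unfolding G.finitely_generated_over_def by blast
    have "S \<union> kernel G H h \<subseteq> carrier G" using S(2) A.subset by (auto simp: kernel_def)
    from generate_img[OF this] have "generate H (h ` (S \<union> kernel G H h) \<union> {}) = h ` A"
      by (simp add: S(3))
    moreover have "h ` (S \<union> kernel G H h) \<subseteq> insert \<one>\<^bsub>H\<^esub> (h ` S)" by (auto simp: kernel_def)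
    hence "finite (h ` (S \<union> kernel G H h))" by (rule finite_subset) (simp add: S(1))
    moreover have "S \<union> kernel G H h \<subseteq> A"
      using generate.incl[of _ "S \<union> kernel G H h" G] S(3) by blast
    ultimately show "H.finitely_generated (h ` A)"
      unfolding H.finitely_generated_over_def
      by (intro exI[of _ "h ` (S \<union> kernel G H h)"] conjI image_mono)
    show "H.finite_mod (lcs H n) (h ` A)"
      unfolding lcs_img by (rule finite_mod_img[OF fin A.subset])
    fix y assume "y \<in> carrier H"
    then obtain x where x: "x \<in> carrier G" "y = h x" using surj by blast
    obtain k :: nat where k: "k > 0" "\<And>a. a \<in> A \<Longrightarrow> commutator G a (x [^] k) \<in> kernel G H h"
      using centralizing_pow[OF x(1)] by blast
    have "h a \<otimes>\<^bsub>H\<^esub> y [^]\<^bsub>H\<^esub> k = y [^]\<^bsub>H\<^esub> k \<otimes>\<^bsub>H\<^esub> h a" if "a \<in> A" for a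
      using commute_img_if_commutator_mem_kernel[OF _ _ k(2)[OF that]] that x
      by (simp add: hom_nat_pow)
    moreover have "h ` A \<subseteq> carrier H" using A.subset by auto
    ultimately have "y [^]\<^bsub>H\<^esub> k \<in> H.centralizer (h ` A)" using x by (simp add: H.mem_centralizer_iff)
    thus "\<exists>k::nat > 0. y [^]\<^bsub>H\<^esub> k \<in> H.centralizer (h ` A)" using k(1) by blast
  qed
  thus "finite (h ` lcs G (Suc n))" by (simp only: lcs_img)
qed

context group
begin

lemma finite_mod_lcs_lcs_in:
  assumes overgroups: non_nilpotent_overgroups_normal
    and N: "N \<lhd> G" "finite_mod (carrier G) N" "finitely_generated N"
  shows "finite_mod (lcs G i) (lcs_in G N i)"
proof (induction i)
  case 0
  show ?case using N(2) by simp
next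
  case (Suc i)
  interpret N: normal N G by (rule N(1))
  interpret next_term: normal "lcs_in G N (Suc i)" G by (rule lcs_in_normal[OF N(1)])
  interpret proj: group_hom G "G Mod lcs_in G N (Suc i)" "(#>) (lcs_in G N (Suc i))"
    by (rule next_term.group_hom_Mod)
  note N_subgroup = N.subgroup_axioms
  have "finite_mod (lcs G (Suc i))
      (kernel G (G Mod lcs_in G N (Suc i)) ((#>) (lcs_in G N (Suc i))))"
  proof (rule proj.finite_mod_lcs_Suc_kernel[OF _ overgroups lcs_in_normal[OF N(1)] _ _ _ Suc],
      unfold next_term.kernel_Mod)
    show "(#>) (lcs_in G N (Suc i)) ` carrier G = carrier (G Mod lcs_in G N (Suc i))"
      by (simp add: carrier_FactGroup)
    show "finitely_generated_over (lcs_in G N (Suc i)) (lcs_in G N i)"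
      by (rule finitely_generated_over_lcs_in_Suc[OF N_subgroup N(3)])
    show "commutator G a b \<in> lcs_in G N (Suc i)" if "a \<in> lcs_in G N i" "b \<in> lcs_in G N i" for a b
      using that lcs_in_subset[OF N_subgroup, of i]
      by (auto intro!: commutator_mem_commutator_subgroup)
    fix x assume "x \<in> carrier G"
    then obtain k :: nat where "k > 0" "x [^] k \<in> N"
      using finite_mod_pow_mem[OF N(2) N_subgroup subgroup_self] by blast
    thus "\<exists>k::nat > 0. \<forall>a \<in> lcs_in G N i. commutator G a (x [^] k) \<in> lcs_in G N (Suc i)"
      by (auto intro!: commutator_mem_commutator_subgroup)
  qed
  thus ?case by (simp only: next_term.kernel_Mod)
qed

lemma exists_finite_lcs:
  assumes overgroups: non_nilpotent_overgroups_normal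
    and N: "N \<lhd> G" "finite_mod (carrier G) N" "finitely_generated N"
      "nilpotent_group (G\<lparr>carrier := N\<rparr>)"
  shows "\<exists>n. finite (lcs G n)"
proof -
  obtain c where c: "lcs_in G N c \<subseteq> {\<one>}"
    using N(4) nilpotent_subgroup_iff[OF normal_imp_subgroup[OF N(1)]] by blast
  have "finite (lcs G c)"
    by (rule finite_if_finite_mod[OF finite_mod_lcs_lcs_in[OF overgroups N(1-3)]
      finite_subset[OF c]]) simp
  thus ?thesis by blast
qed

end

section \<open>Maximal subgroups and their conjugates\<close>

context group
begin

lemma nilpotent_normalizer_grows:
  assumes M: "subgroup M G" "nilpotent_group (G\<lparr>carrier := M\<rparr>)" and D: "subgroup D G" "D \<subset> M"
  obtains y where "y \<in> M" "y \<notin> D" "y \<in> normalizer G D"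
proof -
  interpret D: subgroup D G by fact
  obtain c where "lcs_in G M c \<subseteq> {\<one>}" using M nilpotent_subgroup_iff by blast
  hence "lcs_in G M c \<subseteq> D" using D.one_closed by blast
  then obtain i where i: "lcs_in G M i \<subseteq> D" "\<And>j. j < i \<Longrightarrow> \<not> lcs_in G M j \<subseteq> D"
    using exists_least_iff[of "\<lambda>i. lcs_in G M i \<subseteq> D"] by blast
  have "\<not> lcs_in G M 0 \<subseteq> D" using D(2) by auto
  hence "i \<noteq> 0" using i(1) by metis
  then obtain j where j: "i = Suc j" using not0_implies_Suc by blast
  then obtain y where y: "y \<in> lcs_in G M j" "y \<notin> D" using i(2)[of j] by blast
  have "commutator G d z \<in> D" if d: "d \<in> D" and z: "z \<in> lcs_in G M j" for d z
  proof -
    have "commutator G z d \<in> lcs_in G M (Suc j)"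
      using z d D(2) by (auto intro!: commutator_mem_commutator_subgroup)
    hence "inv (commutator G z d) \<in> D" using i(1) j by auto
    moreover have "z \<in> carrier G" using z lcs_in_subset_carrier[OF M(1)] by blast
    ultimately show ?thesis using d by (simp add: inv_commutator)
  qed
  hence "lcs_in G M j \<subseteq> normalizer G D"
    by (rule subset_normalizer_if_commutators[OF D(1) lcs_in_subgroup[OF M(1)]])
  thus ?thesis using that y lcs_in_subset[OF M(1)] by blast
qed

definition maximal_subgroup :: "'a set \<Rightarrow> bool" where
  "maximal_subgroup M \<longleftrightarrow> subgroup M G \<and> M \<noteq> carrier G \<and>
     (\<forall>K. subgroup K G \<and> M \<subseteq> K \<longrightarrow> K = M \<or> K = carrier G)"

lemma maximal_subgroupD:
  assumes "maximal_subgroup M"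
  shows "subgroup M G" "M \<subseteq> carrier G" "M \<noteq> carrier G"
  using assms subgroup.subset by (auto simp: maximal_subgroup_def)

lemma maximal_subgroup_eq:
  assumes "maximal_subgroup M" "maximal_subgroup K" "M \<subseteq> K"
  shows "M = K"
  using assms unfolding maximal_subgroup_def by blast

lemma maximal_subgroup_exists:
  assumes "finite (carrier G)" "subgroup H G" "H \<noteq> carrier G"
  obtains M where "maximal_subgroup M" "H \<subseteq> M"
proof -
  let ?X = "{K. subgroup K G \<and> K \<noteq> carrier G}"
  have "?X \<subseteq> Pow (carrier G)" using subgroup.subset by blast
  hence "finite ?X" by (rule finite_subset) (simp add: assms(1))
  then obtain M where M: "M \<in> ?X" "H \<subseteq> M" "\<And>K. K \<in> ?X \<Longrightarrow> M \<subseteq> K \<Longrightarrow> M = K"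
    using finite_has_maximal2[of ?X H] assms by auto
  hence "maximal_subgroup M" unfolding maximal_subgroup_def by blast
  thus ?thesis using that M(2) by blast
qed

lemma mem_maximal_subgroup_if_not_comm:
  assumes fin: "finite (carrier G)" and not_comm: "\<not> comm_group G" and g: "g \<in> carrier G"
  obtains M where "maximal_subgroup M" "g \<in> M"
proof -
  have "generate G {g} \<noteq> carrier G"
  proof
    assume eq: "generate G {g} = carrier G"
    have "x \<otimes> y = y \<otimes> x" if xy: "x \<in> carrier G" "y \<in> carrier G" for x y
    proof -
      obtain i j :: int where "x = g [^] i" "y = g [^] j"
        using xy unfolding eq[symmetric] generate_pow[OF g] by blast
      thus ?thesis using g by (simp add: int_pow_mult[symmetric] add.commute)
    qed
    thus False using not_comm group_comm_groupI by blast
  qed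
  moreover have "subgroup (generate G {g}) G" using g by (intro generate_is_subgroup) simp
  ultimately obtain M where "maximal_subgroup M" "generate G {g} \<subseteq> M"
    using maximal_subgroup_exists[OF fin] by blast
  thus ?thesis using that generate.incl[of g "{g}" G] by blast
qed

lemma maximal_subgroup_normalizer:
  assumes "maximal_subgroup M" "\<not> M \<lhd> G"
  shows "normalizer G M = M"
proof -
  note M = maximal_subgroupD[OF assms(1)]
  have "normalizer G M \<noteq> carrier G" using assms(2) normal_iff_normalizer[OF M(1)] by blast
  thus ?thesis
    using assms(1) normalizer_imp_subgroup[OF M(2)] subset_normalizer[OF M(1)]
    unfolding maximal_subgroup_def by blast
qed

abbreviation conjugation_action :: "'a \<Rightarrow> 'a set \<Rightarrow> 'a set" where
  "conjugation_action \<equiv> (\<lambda>g. \<lambda>H \<in> {H. H \<subseteq> carrier G}. g <# H #> inv g)"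

definition conjugates :: "'a set \<Rightarrow> 'a set set" where
  "conjugates M = orbit G conjugation_action M"

lemma conjugates_eq:
  assumes "M \<subseteq> carrier G"
  shows "conjugates M = (\<lambda>g. (\<lambda>m. g \<otimes> m \<otimes> inv g) ` M) ` carrier G"
proof -
  have "conjugates M = (\<lambda>g. g <# M #> inv g) ` carrier G"
    using assms by (auto simp: conjugates_def orbit_def)
  thus ?thesis by (simp add: conj_eq_image)
qed

lemma conjugatesE:
  assumes "C \<in> conjugates M" "M \<subseteq> carrier G"
  obtains g where "g \<in> carrier G" "C = (\<lambda>m. g \<otimes> m \<otimes> inv g) ` M"
  using assms conjugates_eq by blast

lemma conjugates_sym:
  assumes "C \<in> conjugates M" "M \<subseteq> carrier G" "C \<subseteq> carrier G"
  shows "M \<in> conjugates C"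
  using assms group_action.orbit_sym[OF action_by_conjugation_on_power_set, of M C]
  by (simp add: conjugates_def)

lemma conjugates_trans:
  assumes "L \<in> conjugates K" "K \<in> conjugates M" "M \<subseteq> carrier G" "K \<subseteq> carrier G" "L \<subseteq> carrier G"
  shows "L \<in> conjugates M"
  using assms group_action.orbit_trans[OF action_by_conjugation_on_power_set, of M K L]
  by (simp add: conjugates_def)

lemma conjugate_subgroup:
  assumes "C \<in> conjugates M" "subgroup M G"
  shows "subgroup C G"
proof -
  obtain g where "g \<in> carrier G" "C = (\<lambda>m. g \<otimes> m \<otimes> inv g) ` M"
    using conjugatesE[OF assms(1) subgroup.subset[OF assms(2)]] .
  thus ?thesis using group_hom.subgroup_img_is_subgroup[OF conj_hom assms(2)] by simp
qed

lemma card_conjugate: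
  assumes "C \<in> conjugates M" "M \<subseteq> carrier G"
  shows "card C = card M"
proof -
  obtain g where g: "g \<in> carrier G" "C = (\<lambda>m. g \<otimes> m \<otimes> inv g) ` M"
    using conjugatesE[OF assms] .
  have "inj_on (\<lambda>m. g \<otimes> m \<otimes> inv g) M"
    using assms(2) g(1) by (intro inj_onI) (simp add: subset_iff)
  thus ?thesis by (simp add: g(2) card_image)
qed

lemma conjugate_maximal:
  assumes M: "maximal_subgroup M" and C: "C \<in> conjugates M"
  shows "maximal_subgroup C"
  unfolding maximal_subgroup_def
proof (intro conjI allI impI)
  note sub = maximal_subgroupD[OF M]
  show "subgroup C G" by (rule conjugate_subgroup[OF C sub(1)])
  obtain g where g: "g \<in> carrier G" "C = (\<lambda>m. g \<otimes> m \<otimes> inv g) ` M" using conjugatesE[OF C sub(2)] .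
  interpret conj: group_hom G G "\<lambda>y. g \<otimes> y \<otimes> inv g" by (rule conj_hom[OF g(1)])
  have surj: "(\<lambda>y. g \<otimes> y \<otimes> inv g) ` carrier G = carrier G"
    using subsetD[OF subset_normalizer[OF subgroup_self] g(1)]
    by (simp add: mem_normalizer_iff_image)
  have inj: "inj_on (\<lambda>y. g \<otimes> y \<otimes> inv g) (carrier G)" using g(1) by (intro inj_onI) simp
  show "C \<noteq> carrier G"
    using sub(2,3) inj_on_image_eq_iff[OF inj sub(2) subset_refl] by (simp add: g(2) surj)
  fix K assume K: "subgroup K G \<and> C \<subseteq> K"
  let ?L = "{y \<in> carrier G. g \<otimes> y \<otimes> inv g \<in> K}"
  have img: "(\<lambda>y. g \<otimes> y \<otimes> inv g) ` ?L = K"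
    using K subgroup.subset by (intro conj.image_preimage surj) blast
  have "subgroup ?L G" "M \<subseteq> ?L" using K g(2) sub(2) conj.preimage_subgroup by auto
  hence "?L = M \<or> ?L = carrier G" using M unfolding maximal_subgroup_def by blast
  thus "K = C \<or> K = carrier G"
  proof
    assume "?L = M"
    thus ?thesis using img by (simp add: g(2))
  next
    assume "?L = carrier G"
    thus ?thesis using img by (simp add: surj)
  qed
qed

lemma card_conjugates:
  assumes M: "subgroup M G" "normalizer G M = M"
  shows "card (conjugates M) * card M = order G"
  using group_action.orbit_stabilizer_theorem[OF action_by_conjugation_on_power_set, of M]
    M subgroup.subset[OF M(1)] by (simp add: conjugates_def normalizer_def)

definition conjugate_cover :: "'a set \<Rightarrow> 'a set" where
  "conjugate_cover M = (\<Union>C \<in> conjugates M. C - {\<one>})"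

lemma conjugate_cover_subset:
  assumes "subgroup M G"
  shows "conjugate_cover M \<subseteq> carrier G - {\<one>}"
  using conjugate_subgroup[OF _ assms] subgroup.subset unfolding conjugate_cover_def by blast

lemma card_conjugate_cover:
  assumes fin: "finite (carrier G)" and M: "subgroup M G" "normalizer G M = M"
    and inter: "\<And>C C'. \<lbrakk>C \<in> conjugates M; C' \<in> conjugates M; C \<noteq> C'\<rbrakk> \<Longrightarrow> C \<inter> C' \<subseteq> {\<one>}"
  shows "card (conjugate_cover M) + card (conjugates M) = order G"
proof -
  interpret M: subgroup M G by (rule M(1))
  have finite_conjugates: "finite (conjugates M)"
    using fin by (simp add: conjugates_eq[OF M.subset])
  have finite: "finite C" if "C \<in> conjugates M" for C
    using finite_subset[OF subgroup.subset[OF conjugate_subgroup[OF that M(1)]] fin] .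
  have "finite M" by (rule finite_subset[OF M.subset fin])
  hence "card M \<noteq> 0" using M.one_closed by (metis card_eq_0_iff empty_iff)
  then obtain n where n: "card M = Suc n" using not0_implies_Suc by blast
  have "card (C - {\<one>}) = n" if C: "C \<in> conjugates M" for C
    using finite[OF C] subgroup.one_closed[OF conjugate_subgroup[OF C M(1)]]
      card_conjugate[OF C M.subset] n by simp
  moreover have "card (conjugate_cover M) = (\<Sum>C \<in> conjugates M. card (C - {\<one>}))"
    unfolding conjugate_cover_def
    using inter finite by (intro card_UN_disjoint finite_conjugates) blast+
  ultimately have "card (conjugate_cover M) = card (conjugates M) * n" by simp
  thus ?thesis using card_conjugates[OF M] by (simp add: n)
qed

lemma conjugate_cover_bounds:
  assumes fin: "finite (carrier G)" and M: "maximal_subgroup M" "\<not> M \<lhd> G"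
    and inter: "\<And>C C'. \<lbrakk>C \<in> conjugates M; C' \<in> conjugates M; C \<noteq> C'\<rbrakk> \<Longrightarrow> C \<inter> C' \<subseteq> {\<one>}"
  shows "order G \<le> 2 * card (conjugate_cover M)" "card (conjugate_cover M) + 2 \<le> order G"
proof -
  note sub = maximal_subgroupD[OF M(1)]
  interpret M: subgroup M G by (rule sub(1))
  have self_normalizing: "normalizer G M = M" by (rule maximal_subgroup_normalizer[OF M])
  have cover: "card (conjugate_cover M) + card (conjugates M) = order G"
    by (rule card_conjugate_cover[OF fin sub(1) self_normalizing inter])
  have product: "card (conjugates M) * card M = order G"
    by (rule card_conjugates[OF sub(1) self_normalizing])
  have "M \<noteq> {\<one>}" using M(2) one_is_normal by blast
  hence "{\<one>} \<subset> M" using M.one_closed by blast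
  with finite_subset[OF sub(2) fin] have "card {\<one>} < card M" by (rule psubset_card_mono)
  hence "card (conjugates M) * 2 \<le> card (conjugates M) * card M" by (intro mult_le_mono2) simp
  hence "card (conjugates M) * 2 \<le> order G" by (simp only: product)
  thus "order G \<le> 2 * card (conjugate_cover M)" using cover by linarith
  have "card M < order G"
    unfolding order_def using sub(2,3) by (intro psubset_card_mono[OF fin]) blast
  hence "\<not> card (conjugates M) \<le> 1"
    using product mult_le_mono1[of "card (conjugates M)" 1 "card M"] by linarith
  thus "card (conjugate_cover M) + 2 \<le> order G" using cover by linarith
qed

lemma conjugate_covers_disjoint:
  assumes M: "subgroup M G" and K: "subgroup K G" "K \<notin> conjugates M"
    and inter: "\<And>C C'. \<lbrakk>C \<in> conjugates M; C' \<in> conjugates K; C \<noteq> C'\<rbrakk> \<Longrightarrow> C \<inter> C' \<subseteq> {\<one>}"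
  shows "conjugate_cover M \<inter> conjugate_cover K = {}"
proof (rule ccontr)
  assume "conjugate_cover M \<inter> conjugate_cover K \<noteq> {}"
  then obtain C C' y where C: "C \<in> conjugates M" "C' \<in> conjugates K" "y \<in> C" "y \<in> C'" "y \<noteq> \<one>"
    unfolding conjugate_cover_def by blast
  hence "C = C'" using inter by blast
  moreover note carriers = subgroup.subset[OF M] subgroup.subset[OF K(1)]
    subgroup.subset[OF conjugate_subgroup[OF C(1) M]]
  ultimately have "K \<in> conjugates C" using conjugates_sym C(2) by blast
  hence "K \<in> conjugates M" using conjugates_trans C(1) carriers by blast
  thus False using K(2) by blast
qed

lemma card_conjugate_covers_less:
  assumes fin: "finite (carrier G)" and M: "subgroup M G" and K: "subgroup K G"
    and disjoint: "conjugate_cover M \<inter> conjugate_cover K = {}"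
  shows "card (conjugate_cover M) + card (conjugate_cover K) < order G"
proof -
  note cover_subset = conjugate_cover_subset[OF M] conjugate_cover_subset[OF K]
  have finite: "finite (carrier G - {\<one>})" using fin by simp
  have "card (conjugate_cover M) + card (conjugate_cover K)
      = card (conjugate_cover M \<union> conjugate_cover K)"
    using finite_subset[OF cover_subset(1) finite] finite_subset[OF cover_subset(2) finite]
    by (rule card_Un_disjoint[symmetric]) (rule disjoint)
  also have "\<dots> \<le> card (carrier G - {\<one>})"
    by (rule card_mono[OF finite Un_least[OF cover_subset]])
  also have "\<dots> < order G" unfolding order_def by (rule card_Diff1_less[OF fin one_closed])
  finally show ?thesis .
qed

end

section \<open>Schmidt's theorem\<close>

definition (in group) proper_subgroups_nilpotent :: bool where
  "proper_subgroups_nilpotent \<longleftrightarrow>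
     (\<forall>H. subgroup H G \<and> H \<noteq> carrier G \<longrightarrow> nilpotent_group (G\<lparr>carrier := H\<rparr>))"

lemma (in group_hom) proper_subgroups_nilpotent_img:
  assumes surj: "h ` carrier G = carrier H" and nilpotent: "G.proper_subgroups_nilpotent"
  shows "H.proper_subgroups_nilpotent"
  unfolding H.proper_subgroups_nilpotent_def
proof (intro allI impI, elim conjE)
  fix K assume K: "subgroup K H" "K \<noteq> carrier H"
  let ?preimage = "{x \<in> carrier G. h x \<in> K}"
  have img: "h ` ?preimage = K" by (rule image_preimage[OF surj subgroup.subset[OF K(1)]])
  hence "?preimage \<noteq> carrier G" using surj K(2) by metis
  hence "nilpotent_group (G\<lparr>carrier := ?preimage\<rparr>)"
    using nilpotent preimage_subgroup[OF K(1)] unfolding G.proper_subgroups_nilpotent_def by blast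
  from nilpotent_img[OF preimage_subgroup[OF K(1)] this]
  show "nilpotent_group (H\<lparr>carrier := K\<rparr>)" by (simp only: img)
qed

lemma (in group) normal_if_largest_maximal_inter:
  assumes fin: "finite (carrier G)" and nilpotent: proper_subgroups_nilpotent
    and AB: "maximal_subgroup A" "maximal_subgroup B" "A \<noteq> B"
    and largest: "\<And>A' B'. \<lbrakk>maximal_subgroup A'; maximal_subgroup B'; A' \<noteq> B'\<rbrakk>
      \<Longrightarrow> card (A' \<inter> B') \<le> card (A \<inter> B)"
  shows "A \<inter> B \<lhd> G"
proof (rule ccontr)
  assume not_normal: "\<not> A \<inter> B \<lhd> G"
  let ?D = "A \<inter> B"
  note sub = maximal_subgroupD[OF AB(1)] maximal_subgroupD[OF AB(2)]
  have D: "subgroup ?D G" using sub by (intro subgroups_Inter_pair)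
  interpret D: subgroup ?D G by (rule D)
  have "normalizer G ?D \<noteq> carrier G" using not_normal normal_iff_normalizer[OF D] by blast
  then obtain M where M: "maximal_subgroup M" "normalizer G ?D \<subseteq> M"
    using maximal_subgroup_exists[OF fin normalizer_imp_subgroup[OF D.subset]] by blast
  have unique: "K = M" if K: "maximal_subgroup K" "?D \<subset> K" for K
  proof (rule ccontr)
    assume "K \<noteq> M"
    note K_sub = maximal_subgroupD[OF K(1)]
    have "nilpotent_group (G\<lparr>carrier := K\<rparr>)"
      using nilpotent K_sub unfolding proper_subgroups_nilpotent_def by blast
    then obtain y where "y \<in> K" "y \<notin> ?D" "y \<in> normalizer G ?D"
      using nilpotent_normalizer_grows[OF K_sub(1) _ D K(2)] by blast
    hence "?D \<subset> K \<inter> M" using M(2) K(2) subset_normalizer[OF D] by blast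
    moreover have "finite (K \<inter> M)" using finite_subset[OF K_sub(2) fin] by simp
    ultimately have "card ?D < card (K \<inter> M)" by (rule psubset_card_mono[rotated])
    thus False using largest[OF K(1) M(1) \<open>K \<noteq> M\<close>] by simp
  qed
  have "?D \<subset> A" "?D \<subset> B" using maximal_subgroup_eq[of A B] maximal_subgroup_eq[of B A] AB by blast+
  hence "A = M" "B = M" using unique AB by blast+
  thus False using AB(3) by simp
qed

lemma (in group) maximal_inter_trivial:
  assumes fin: "finite (carrier G)" and nilpotent: proper_subgroups_nilpotent
    and normal_inter: "\<And>A B. \<lbrakk>maximal_subgroup A; maximal_subgroup B; A \<noteq> B; A \<inter> B \<lhd> G\<rbrakk>
      \<Longrightarrow> A \<inter> B = {\<one>}"
    and maximal: "maximal_subgroup M" "maximal_subgroup K" "M \<noteq> K"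
  shows "M \<inter> K = {\<one>}"
proof -
  let ?P = "\<lambda>(A, B). maximal_subgroup A \<and> maximal_subgroup B \<and> A \<noteq> B"
  have "card (fst p \<inter> snd p) < Suc (card (carrier G))" if "?P p" for p
  proof -
    have "fst p \<inter> snd p \<subseteq> carrier G"
      using that maximal_subgroupD(2)[of "fst p"] by (auto simp: case_prod_beta)
    thus ?thesis using card_mono[OF fin] by (simp add: less_Suc_eq_le)
  qed
  moreover have "?P (M, K)" using maximal by simp
  ultimately obtain p where p: "?P p" "\<And>q. ?P q \<Longrightarrow> card (fst q \<inter> snd q) \<le> card (fst p \<inter> snd p)"
    using ex_has_greatest_nat[of ?P "(M, K)" "\<lambda>p. card (fst p \<inter> snd p)"] by blast
  obtain A B where AB: "p = (A, B)" "maximal_subgroup A" "maximal_subgroup B" "A \<noteq> B"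
    using p(1) by (cases p) auto
  have largest: "card (A' \<inter> B') \<le> card (A \<inter> B)"
    if "maximal_subgroup A'" "maximal_subgroup B'" "A' \<noteq> B'" for A' B'
    using p(2)[of "(A', B')"] that by (simp add: AB(1))
  have "A \<inter> B = {\<one>}"
    by (rule normal_inter[OF AB(2-4) normal_if_largest_maximal_inter[OF fin nilpotent AB(2-4)
      largest]])
  hence "card (M \<inter> K) \<le> card {\<one>}" using largest[OF maximal] by simp
  moreover have "{\<one>} \<subseteq> M \<inter> K" using maximal(1,2) maximal_subgroupD(1) subgroup.one_closed by blast
  moreover have "finite (M \<inter> K)"
    using finite_subset[OF maximal_subgroupD(2)[OF maximal(1)] fin] by simp
  ultimately show ?thesis using card_seteq by blast
qed

text \<open>The conjugates of one maximal subgroup cover at least half of the group, but not all of it;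
  those of a maximal subgroup containing a missed element cover another half.\<close>
lemma (in simple_group) comm_group_if_proper_subgroups_nilpotent:
  assumes fin: "finite (carrier G)" and nilpotent: proper_subgroups_nilpotent
  shows "comm_group G"
proof (rule ccontr)
  assume not_comm: "\<not> comm_group G"
  have inter: "M \<inter> K = {\<one>}" if "maximal_subgroup M" "maximal_subgroup K" "M \<noteq> K" for M K
    using no_real_normal_subgroup maximal_subgroupD(2,3)
    by (intro maximal_inter_trivial[OF fin nilpotent _ that]) blast
  have inter_conjugates: "C \<inter> C' \<subseteq> {\<one>}"
    if "maximal_subgroup M" "maximal_subgroup K" "C \<in> conjugates M" "C' \<in> conjugates K" "C \<noteq> C'"
    for M K C C'
    using inter[OF conjugate_maximal[OF that(1,3)] conjugate_maximal[OF that(2,4)] that(5)] by simp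
  have bounds: "order G \<le> 2 * card (conjugate_cover M)" "card (conjugate_cover M) + 2 \<le> order G"
    if M: "maximal_subgroup M" "y \<in> M" "y \<noteq> \<one>" for M y
  proof -
    have "\<not> M \<lhd> G" using no_real_normal_subgroup maximal_subgroupD(3)[OF M(1)] M(2,3) by blast
    thus "order G \<le> 2 * card (conjugate_cover M)" "card (conjugate_cover M) + 2 \<le> order G"
      using conjugate_cover_bounds[OF fin M(1) _ inter_conjugates[OF M(1) M(1)]] by blast+
  qed
  obtain x where x: "x \<in> carrier G" "x \<noteq> \<one>" using simple_not_triv one_closed by blast
  obtain M where M: "maximal_subgroup M" "x \<in> M"
    using mem_maximal_subgroup_if_not_comm[OF fin not_comm x(1)] .
  note M_subgroup = maximal_subgroupD(1)[OF M(1)]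
  have "conjugate_cover M \<noteq> carrier G - {\<one>}"
  proof
    assume "conjugate_cover M = carrier G - {\<one>}"
    thus False using bounds(2)[OF M x(2)] fin by (simp add: order_def)
  qed
  then obtain g where g: "g \<in> carrier G" "g \<noteq> \<one>" "g \<notin> conjugate_cover M"
    using conjugate_cover_subset[OF M_subgroup] by blast
  obtain K where K: "maximal_subgroup K" "g \<in> K"
    using mem_maximal_subgroup_if_not_comm[OF fin not_comm g(1)] .
  note K_subgroup = maximal_subgroupD(1)[OF K(1)]
  have "K \<notin> conjugates M" using K(2) g(2,3) by (auto simp: conjugate_cover_def)
  hence "conjugate_cover M \<inter> conjugate_cover K = {}"
    by (rule conjugate_covers_disjoint[OF M_subgroup K_subgroup _ inter_conjugates[OF M(1) K(1)]])
  hence "card (conjugate_cover M) + card (conjugate_cover K) < order G"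
    by (rule card_conjugate_covers_less[OF fin M_subgroup K_subgroup])
  thus False using bounds(1)[OF M x(2)] bounds(1)[OF K g(2)] by linarith
qed

context group
begin

lemma exists_simple_quotient:
  assumes fin: "finite (carrier G)" and nontrivial: "carrier G \<noteq> {\<one>}"
  obtains R where "R \<lhd> G" "simple_group (G Mod R)"
proof -
  let ?X = "{N. N \<lhd> G \<and> N \<noteq> carrier G}"
  have "?X \<subseteq> Pow (carrier G)" using subgroup.subset normal_imp_subgroup by blast
  hence "finite ?X" by (rule finite_subset) (simp add: fin)
  moreover have "{\<one>} \<in> ?X" using one_is_normal nontrivial by blast
  ultimately obtain R where R: "R \<lhd> G" "R \<noteq> carrier G"
    and maximal: "\<And>N. \<lbrakk>N \<lhd> G; N \<noteq> carrier G; R \<subseteq> N\<rbrakk> \<Longrightarrow> R = N"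
    using finite_has_maximal2[of ?X "{\<one>}"] by auto
  interpret R: normal R G by (rule R(1))
  interpret proj: group_hom G "G Mod R" "(#>) R" by (rule R.group_hom_Mod)
  have onto: "(#>) R ` carrier G = carrier (G Mod R)" by (simp add: carrier_FactGroup)
  have "simple_group (G Mod R)"
  proof
    have "finite (carrier (G Mod R))" using fin by (simp flip: onto)
    moreover have "carrier (G Mod R) \<noteq> {\<one>\<^bsub>G Mod R\<^esub>}"
      using R.fact_group_trivial_iff[OF fin] R(2) by blast
    ultimately show "1 < order (G Mod R)"
      using proj.H.order_gt_0_iff_finite proj.H.order_one_triv_iff by linarith
    fix N assume N: "N \<lhd> G Mod R"
    interpret N: normal N "G Mod R" by (rule N)
    let ?preimage = "{x \<in> carrier G. R #> x \<in> N}"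
    have img: "(#>) R ` ?preimage = N" by (rule proj.image_preimage[OF onto N.subset])
    have proj_R: "R #> r = \<one>\<^bsub>G Mod R\<^esub>" if "r \<in> R" for r
      using that coset_join2[OF _ R.subgroup_axioms] by simp
    hence "R \<subseteq> ?preimage" using N.one_closed by auto
    hence "?preimage = carrier G \<or> ?preimage = R"
      using maximal[OF proj.preimage_normal[OF N]] by blast
    thus "N = carrier (G Mod R) \<or> N = {\<one>\<^bsub>G Mod R\<^esub>}"
    proof
      assume "?preimage = carrier G"
      thus ?thesis using img onto by simp
    next
      assume "?preimage = R"
      hence "N = (#>) R ` R" using img by simp
      hence "N \<subseteq> {\<one>\<^bsub>G Mod R\<^esub>}" using proj_R by blast
      thus ?thesis using N.one_closed by blast
    qed
  qed
  thus ?thesis using that R(1) by blast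
qed

lemma derived_neq_if_proper_subgroups_nilpotent:
  assumes fin: "finite (carrier G)" and nontrivial: "carrier G \<noteq> {\<one>}"
    and nilpotent: proper_subgroups_nilpotent
  shows "derived G (carrier G) \<noteq> carrier G"
proof -
  obtain R where R: "R \<lhd> G" "simple_group (G Mod R)"
    using exists_simple_quotient[OF fin nontrivial] .
  interpret R: normal R G by (rule R(1))
  interpret proj: group_hom G "G Mod R" "(#>) R" by (rule R.group_hom_Mod)
  interpret simple: simple_group "G Mod R" by (rule R(2))
  have onto: "(#>) R ` carrier G = carrier (G Mod R)" by (simp add: carrier_FactGroup)
  have "comm_group (G Mod R)"
    using fin proj.proper_subgroups_nilpotent_img[OF onto nilpotent]
    by (intro simple.comm_group_if_proper_subgroups_nilpotent) (simp_all flip: onto)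
  hence "derived G (carrier G) \<subseteq> R" by (rule derived_minimal[OF R(1)])
  moreover have "R \<noteq> carrier G"
    using R.fact_group_trivial_iff[OF fin] simple.simple_not_triv by blast
  ultimately show ?thesis using R.subset by blast
qed

lemma solvable_seq_if_proper_subgroups_nilpotent:
  assumes E: "subgroup E G" "finite E"
    and nilpotent: "\<And>H. \<lbrakk>subgroup H G; H \<subset> E\<rbrakk> \<Longrightarrow> nilpotent_group (G\<lparr>carrier := H\<rparr>)"
  shows "solvable_seq G E"
proof (cases "E = {\<one>}")
  case True
  thus ?thesis by (simp add: solvable_seq.unity)
next
  case False
  interpret E: group "G\<lparr>carrier := E\<rparr>" by (rule subgroup.subgroup_is_group[OF E(1) is_group])
  have "E.proper_subgroups_nilpotent"
    unfolding E.proper_subgroups_nilpotent_def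
  proof (intro allI impI, elim conjE)
    fix H assume H: "subgroup H (G\<lparr>carrier := E\<rparr>)" "H \<noteq> carrier (G\<lparr>carrier := E\<rparr>)"
    have "subgroup H G" by (rule incl_subgroup[OF E(1) H(1)])
    moreover have "H \<subset> E" using subgroup.subset[OF H(1)] H(2) by auto
    ultimately show "nilpotent_group (G\<lparr>carrier := E, carrier := H\<rparr>)" using nilpotent by simp
  qed
  hence "derived (G\<lparr>carrier := E\<rparr>) E \<noteq> E"
    using E.derived_neq_if_proper_subgroups_nilpotent E(2) False by simp
  hence "derived G E \<subset> E"
    using derived_consistent[OF subset_refl E(1)] derived_incl[OF subset_refl E(1)] by auto
  moreover have derived: "subgroup (derived G E) G"
    by (rule derived_is_subgroup[OF subgroup.subset[OF E(1)]])
  ultimately have "solvable_seq G (derived G E)"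
    by (intro solvable_seq_if_nilpotent nilpotent)
  thus ?thesis by (rule augment_solvable_seq[OF E(1)])
qed

end

section \<open>Groups in which all subgroups are normal\<close>

context group
begin

text \<open>The automorphisms of a cyclic group commute.\<close>
lemma commutator_mem_centralizer_if_conj_powers:
  assumes carrier: "u \<in> carrier G" "a \<in> carrier G" "b \<in> carrier G"
    and i: "a \<otimes> u \<otimes> inv a = u [^] (i::int)" and j: "b \<otimes> u \<otimes> inv b = u [^] (j::int)"
  shows "commutator G a b \<in> centralizer {u}"
proof -
  interpret conj_a: group_hom G G "\<lambda>y. a \<otimes> y \<otimes> inv a" by (rule conj_hom[OF carrier(2)])
  interpret conj_b: group_hom G G "\<lambda>y. b \<otimes> y \<otimes> inv b" by (rule conj_hom[OF carrier(3)])
  have "b \<otimes> u [^] i \<otimes> inv b = u [^] (j * i)"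
    using conj_b.hom_int_pow[OF carrier(1), of i] carrier(1) unfolding j by (simp add: int_pow_pow)
  also have "\<dots> = a \<otimes> u [^] j \<otimes> inv a"
    using conj_a.hom_int_pow[OF carrier(1), of j] carrier(1) unfolding i
    by (simp add: int_pow_pow mult.commute)
  finally have eq: "b \<otimes> (a \<otimes> u \<otimes> inv a) \<otimes> inv b = a \<otimes> (b \<otimes> u \<otimes> inv b) \<otimes> inv a"
    unfolding i j .
  have "u \<otimes> commutator G a b = inv a \<otimes> inv b \<otimes> (b \<otimes> (a \<otimes> u \<otimes> inv a) \<otimes> inv b) \<otimes> a \<otimes> b"
    using carrier by (simp add: word_simps)
  also have "\<dots> = commutator G a b \<otimes> u" unfolding eq using carrier by (simp add: word_simps)
  finally show ?thesis using carrier by (simp add: mem_centralizer_iff)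
qed

lemma derived_derived_trivial_if_cyclic_subgroups_normal:
  assumes F: "subgroup F G"
    and cyclic_normal: "\<And>x g. \<lbrakk>x \<in> F; g \<in> F\<rbrakk> \<Longrightarrow> g \<otimes> x \<otimes> inv g \<in> generate G {x}"
  shows "derived G (derived G F) \<subseteq> {\<one>}"
proof -
  interpret F: subgroup F G by fact
  have conj_pow: "\<exists>i::int. g \<otimes> x \<otimes> inv g = x [^] i" if "x \<in> F" "g \<in> F" for x g
    using cyclic_normal[OF that] generate_pow[OF F.mem_carrier[OF that(1)]] by auto
  have centralizes: "commutator G a b \<in> centralizer {x}" if mem: "x \<in> F" "a \<in> F" "b \<in> F" for x a b
  proof -
    obtain i j :: int where "a \<otimes> x \<otimes> inv a = x [^] i" "b \<otimes> x \<otimes> inv b = x [^] j"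
      using conj_pow[OF mem(1,2)] conj_pow[OF mem(1,3)] by blast
    thus ?thesis using mem by (intro commutator_mem_centralizer_if_conj_powers) auto
  qed
  have derived_centralizes: "derived G F \<subseteq> centralizer {x}" if x: "x \<in> F" for x
    unfolding derived_eq_commutator_subgroup[OF F] using x centralizes triv_subgroup
    by (intro commutator_subgroup_subset centralizer_mod_subgroup) auto
  have derived: "subgroup (derived G F) G" "derived G F \<subseteq> F"
    using derived_is_subgroup[OF F.subset] derived_incl[OF subset_refl F] by auto
  have "commutator G x c \<in> {\<one>}" if "x \<in> derived G F" "c \<in> derived G F" for x c
    using derived_centralizes[of x] that derived(2) by (auto simp: centralizer_mod_def)
  thus ?thesis
    unfolding derived_eq_commutator_subgroup[OF derived(1)]
    by (intro commutator_subgroup_subset triv_subgroup)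
qed

end

lemma (in group_hom) hom_kernel_mult_int_pow:
  assumes "e \<in> kernel G H h" "x \<in> carrier G"
  shows "h (e \<otimes> x [^] (i::int)) = h x [^]\<^bsub>H\<^esub> i"
  using assms by (simp add: kernel_def hom_int_pow)

lemma (in group_hom) derived_derived_subset_kernel_if_overgroups_normal:
  assumes F: "subgroup F G" "kernel G H h \<subseteq> F"
    and overgroups_normal:
      "\<And>K. \<lbrakk>subgroup K G; kernel G H h \<subseteq> K; K \<subseteq> F\<rbrakk> \<Longrightarrow> K \<lhd> G"
  shows "derived G (derived G F) \<subseteq> kernel G H h"
proof -
  interpret F: subgroup F G by (rule F(1))
  let ?E = "kernel G H h"
  interpret E: normal ?E G by (rule normal_kernel)
  have "h g \<otimes>\<^bsub>H\<^esub> h x \<otimes>\<^bsub>H\<^esub> inv\<^bsub>H\<^esub> h g \<in> generate H {h x}" if x: "x \<in> F" and g: "g \<in> F" for x g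
  proof -
    have carrier: "x \<in> carrier G" "g \<in> carrier G" using x g by auto
    have "x \<in> normalizer G ?E"
      using carrier(1) normal_kernel G.normal_iff_normalizer[OF E.subgroup_axioms] by blast
    hence ext: "subgroup (G.cyclic_extension ?E x) G"
      by (rule G.cyclic_extension_subgroup[OF E.subgroup_axioms])
    have "G.cyclic_extension ?E x \<lhd> G"
      using G.cyclic_extension_subset[OF F x] G.subset_cyclic_extension[OF E.subset]
      by (intro overgroups_normal ext)
    then interpret ext: normal "G.cyclic_extension ?E x" G .
    have "g \<otimes> x \<otimes> inv g \<in> G.cyclic_extension ?E x"
      by (intro ext.inv_op_closed2 G.mem_cyclic_extension E.subgroup_axioms carrier)
    then obtain e and i :: int where e: "e \<in> ?E" "g \<otimes> x \<otimes> inv g = e \<otimes> x [^] i"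
      unfolding G.cyclic_extension_def by blast
    have "h g \<otimes>\<^bsub>H\<^esub> h x \<otimes>\<^bsub>H\<^esub> inv\<^bsub>H\<^esub> h g = h (g \<otimes> x \<otimes> inv g)" using carrier by simp
    also have "\<dots> = h x [^]\<^bsub>H\<^esub> i" unfolding e(2) by (rule hom_kernel_mult_int_pow[OF e(1) carrier(1)])
    finally have "h g \<otimes>\<^bsub>H\<^esub> h x \<otimes>\<^bsub>H\<^esub> inv\<^bsub>H\<^esub> h g = h x [^]\<^bsub>H\<^esub> i" .
    thus ?thesis unfolding H.generate_pow[OF hom_closed[OF carrier(1)]] by blast
  qed
  hence "derived H (derived H (h ` F)) \<subseteq> {\<one>\<^bsub>H\<^esub>}"
    by (intro H.derived_derived_trivial_if_cyclic_subgroups_normal subgroup_img_is_subgroup F(1))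
      auto
  moreover note derived = G.derived_in_carrier[OF F.subset]
  ultimately have "h ` derived G (derived G F) \<subseteq> {\<one>\<^bsub>H\<^esub>}"
    by (simp add: derived_img[OF F.subset] derived_img[OF derived])
  thus ?thesis using G.derived_in_carrier[OF derived] unfolding kernel_def by blast
qed

section \<open>The insoluble case\<close>

context group
begin

lemma int_pow_mem_finite_subgroup:
  assumes F: "subgroup F G" "finite F" and z: "z \<in> carrier G" "ord z = 0" "z [^] (i::int) \<in> F"
  shows "i = 0"
proof -
  interpret F: group "G\<lparr>carrier := F\<rparr>" by (rule subgroup.subgroup_is_group[OF F(1) is_group])
  have "(z [^] i) [^] card F = \<one>"
    using F.pow_order_eq_1[of "z [^] i"] z(3) by (simp add: order_def flip: nat_pow_consistent)
  hence "z [^] (i * int (card F)) = \<one>" using z(1) by (simp add: int_pow_pow flip: int_pow_int)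
  hence "i * int (card F) = 0" using int_pow_eq_id[OF z(1)] z(2) by simp
  moreover have "card F \<noteq> 0"
    using F(2) subgroup.one_closed[OF F(1)] by (metis card_eq_0_iff empty_iff)
  ultimately show ?thesis by simp
qed

lemma cyclic_extension_square_psubset:
  assumes E: "subgroup E G" "finite E" and z: "z \<in> carrier G" "ord z = 0"
  shows "cyclic_extension E (z [^] (2::int)) \<subset> cyclic_extension E z"
proof
  interpret E: subgroup E G by (rule E(1))
  show "cyclic_extension E (z [^] (2::int)) \<subseteq> cyclic_extension E z"
    unfolding cyclic_extension_def using z(1) by (auto simp: int_pow_pow)
  have "z \<notin> cyclic_extension E (z [^] (2::int))"
  proof
    assume "z \<in> cyclic_extension E (z [^] (2::int))"
    then obtain e and i :: int where e: "e \<in> E" "z = e \<otimes> z [^] (2 * i)"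
      using z(1) by (auto simp: cyclic_extension_def int_pow_pow)
    have "z [^] (1 - 2 * i) = z \<otimes> inv (z [^] (2 * i))"
      using int_pow_diff[OF z(1), of 1 "2 * i"] z(1) by simp
    also have "\<dots> = e" using e z(1) by (metis E.mem_carrier int_pow_closed inv_solve_right')
    finally have "1 - 2 * i = 0"
      using e(1) by (intro int_pow_mem_finite_subgroup[OF E z]) simp
    thus False by presburger
  qed
  thus "cyclic_extension E (z [^] (2::int)) \<noteq> cyclic_extension E z"
    using mem_cyclic_extension[OF E(1) z(1)] by blast
qed

lemma normal_if_not_nilpotent_if_centralized:
  assumes overgroups: non_nilpotent_overgroups_normal and F: "F \<lhd> G" "finite F"
    and z: "z \<in> centralizer F" "ord z = 0"
    and E: "subgroup E G" "E \<subseteq> F" "\<not> nilpotent_group (G\<lparr>carrier := E\<rparr>)"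
  shows "E \<lhd> G"
proof -
  interpret F: normal F G by (rule F)
  interpret E: subgroup E G by (rule E)
  have E_finite: "finite E" by (rule finite_subset[OF E(2) F(2)])
  have z_carrier: "z \<in> carrier G" using z(1) by (simp add: mem_centralizer_iff[OF F.subset])
  have "z \<in> centralizer E" using z(1) E(2) by (auto simp: centralizer_mod_def)
  hence z_normalizes: "z \<in> normalizer G E" using centralizer_subset_normalizer[OF E.subset] by blast
  have z2_normalizes: "z [^] (2::int) \<in> normalizer G E"
    by (rule subgroup_int_pow_closed[OF normalizer_imp_subgroup[OF E.subset] z_normalizes])
  let ?H = "cyclic_extension E z" and ?K = "cyclic_extension E (z [^] (2::int))"
  have HK: "subgroup ?H G" "subgroup ?K G"
    using cyclic_extension_subgroup[OF E(1)] z_normalizes z2_normalizes by auto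
  have "\<not> nilpotent_group (G\<lparr>carrier := ?K\<rparr>)"
    using nilpotent_subgroup_mono[OF E(1) HK(2) subset_cyclic_extension[OF E.subset]] E(3) by blast
  hence "?H \<lhd> G"
    by (rule non_nilpotent_overgroups_normalD[OF overgroups HK
      cyclic_extension_square_psubset[OF E(1) E_finite z_carrier z(2)]])
  hence "?H \<inter> F \<lhd> G" by (rule normal_subgroup_intersect[OF _ F(1)])
  moreover have "z [^] i = \<one>" if "z [^] i \<in> F" for i :: int
    using int_pow_mem_finite_subgroup[OF F.subgroup_axioms F(2) z_carrier z(2) that] by simp
  hence "?H \<inter> F = E" by (rule cyclic_extension_inter[OF E(1,2) F.subgroup_axioms z_carrier])
  ultimately show ?thesis by simp
qed

lemma solvable_seq_if_non_nilpotent_subgroups_normal: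
  assumes F: "subgroup F G" "finite F"
    and normal: "\<And>E. \<lbrakk>subgroup E G; E \<subseteq> F; \<not> nilpotent_group (G\<lparr>carrier := E\<rparr>)\<rbrakk> \<Longrightarrow> E \<lhd> G"
  shows "solvable_seq G F"
proof (cases "nilpotent_group (G\<lparr>carrier := F\<rparr>)")
  case True
  thus ?thesis by (rule solvable_seq_if_nilpotent[OF F(1)])
next
  case False
  let ?P = "\<lambda>E. subgroup E G \<and> E \<subseteq> F \<and> \<not> nilpotent_group (G\<lparr>carrier := E\<rparr>)"
  have "?P F" using False F(1) by blast
  then obtain E where E: "?P E" and least: "\<And>K. ?P K \<Longrightarrow> card E \<le> card K"
    using ex_has_least_nat[of ?P F card] by blast
  have E_finite: "finite E" using E F(2) finite_subset by blast
  have "solvable_seq G E"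
  proof (rule solvable_seq_if_proper_subgroups_nilpotent)
    fix H assume H: "subgroup H G" "H \<subset> E"
    have "card H < card E" using H(2) E_finite by (simp add: psubset_card_mono)
    thus "nilpotent_group (G\<lparr>carrier := H\<rparr>)" using least[of H] H E by force
  qed (use E E_finite in auto)
  moreover have "E \<lhd> G" using E normal by blast
  then interpret E: normal E G .
  interpret proj: group_hom G "G Mod E" "(#>) E" by (rule E.group_hom_Mod)
  have "derived G (derived G F) \<subseteq> kernel G (G Mod E) ((#>) E)"
  proof (rule proj.derived_derived_subset_kernel_if_overgroups_normal, unfold E.kernel_Mod)
    show "subgroup F G" "E \<subseteq> F" using E F(1) by blast+
    fix K assume K: "subgroup K G" "E \<subseteq> K" "K \<subseteq> F"
    have "\<not> nilpotent_group (G\<lparr>carrier := K\<rparr>)" using nilpotent_subgroup_mono[OF _ K(1,2)] E by blast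
    thus "K \<lhd> G" using normal K by blast
  qed
  hence "(derived G ^^ 2) F \<subseteq> E" by (simp add: E.kernel_Mod numeral_2_eq_2)
  ultimately show ?thesis using solvable_seq_if_exp_of_derived_subset[OF F(1)] by blast
qed

lemma solvable_if_infinite:
  assumes overgroups: non_nilpotent_overgroups_normal
    and N: "N \<lhd> G" "finite_mod (carrier G) N" "finitely_generated N"
      "nilpotent_group (G\<lparr>carrier := N\<rparr>)"
    and infinite: "infinite (carrier G)"
  shows "solvable G"
proof -
  interpret N: normal N G by (rule N(1))
  obtain n where n: "finite (lcs G n)" using exists_finite_lcs[OF overgroups N] by blast
  interpret F: normal "lcs G n" G by (rule lcs_normal)
  have "infinite N" using infinite finite_if_finite_mod[OF N(2)] by blast
  then obtain y where y: "y \<in> N" "ord y = 0"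
    using nilpotent_torsion_finite[OF N.subgroup_axioms N(3,4)] by blast
  have "finite_mod (carrier G) (centralizer (lcs G n))"
    by (rule finite_mod_centralizer[OF lcs_normal n])
  then obtain k :: nat where k: "k > 0" "y [^] k \<in> centralizer (lcs G n)"
    using finite_mod_pow_mem[OF _ centralizer_mod_subgroup[OF triv_subgroup F.subset] subgroup_self]
      N.mem_carrier[OF y(1)] by blast
  have "ord (y [^] k) = 0" using y k(1) by (simp add: ord_pow_gen)
  hence "solvable_seq G (lcs G n)"
    using normal_if_not_nilpotent_if_centralized[OF overgroups lcs_normal n k(2)]
    by (intro solvable_seq_if_non_nilpotent_subgroups_normal[OF F.subgroup_axioms n])
  moreover have "(derived G ^^ n) (carrier G) \<subseteq> lcs G n"
    using exp_of_derived_subset_lcs_in[OF subgroup_self, of n] by (simp add: lcs_in_carrier)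
  ultimately show ?thesis
    unfolding solvable_def by (intro solvable_seq_if_exp_of_derived_subset[OF subgroup_self])
qed

lemma exists_normal_nilpotent_finite_index:
  assumes fg: "finitely_generated (carrier G)"
    and H: "subgroup H G" "nilpotent_group (G\<lparr>carrier := H\<rparr>)" "finite (rcosets H)"
  obtains N where "N \<lhd> G" "finite_mod (carrier G) N" "finitely_generated N"
    "nilpotent_group (G\<lparr>carrier := N\<rparr>)"
proof
  note core = normal_imp_subgroup[OF normal_core_normal[OF H(1)]]
  show "normal_core H \<lhd> G" by (rule normal_core_normal[OF H(1)])
  show fin: "finite_mod (carrier G) (normal_core H)" by (rule finite_mod_normal_core[OF H(1,3)])
  show "finitely_generated (normal_core H)"
    by (rule finitely_generated_if_finite_mod[OF fg core fin])
  show "nilpotent_group (G\<lparr>carrier := normal_core H\<rparr>)"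
    by (rule nilpotent_subgroup_mono[OF core H(1) normal_core_subset H(2)])
qed

end

theorem mainTheorem12:
  fixes G :: "('a, 'b) monoid_scheme"
  assumes "group G"
    and "finitely_generated_group G"
    and "para_Nil_Hamiltonian G"
    and "\<exists>H. subgroup H G \<and> nilpotent_group (G\<lparr>carrier := H\<rparr>) \<and> finite (rcosets\<^bsub>G\<^esub> H)"
  shows "(\<exists>n::nat. n > 0 \<and> finite (gamma G n)) \<and> (\<not> solvable G \<longrightarrow> finite (carrier G))"
proof -
  interpret group G by fact
  have overgroups: non_nilpotent_overgroups_normal
    using assms(3) by (rule para_Nil_Hamiltonian_imp_non_nilpotent_overgroups_normal)
  have "finitely_generated (carrier G)"
    using assms(2) by (simp add: finitely_generated_group_def finitely_generated_over_def)
  then obtain N where N: "N \<lhd> G" "finite_mod (carrier G) N" "finitely_generated N"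
    "nilpotent_group (G\<lparr>carrier := N\<rparr>)"
    using assms(4) exists_normal_nilpotent_finite_index by blast
  obtain n where "finite (lcs G n)" using exists_finite_lcs[OF overgroups N] by blast
  hence "finite (gamma G (Suc n))" by (simp add: gamma_def)
  moreover have "finite (carrier G)" if "\<not> solvable G"
    using solvable_if_infinite[OF overgroups N] that by blast
  ultimately show ?thesis by blast
qed

end
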